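(* Let $\mathcal{G}=(\mathcal{V},\mathcal{E})$ be an infinite triangle-free graph with maximum degree $\Delta=\max_{v\in\mathcal{V}}\Delta(v)<\infty$, and let $\mathcal{L}=(L(v):v\in\mathcal{V})$ be color lists with $L(v)\subseteq\{1,\dots,q\}$. Let $\alpha^*$ be the unique root of $xe^{-1/x}=1$. Suppose that for some constant $\alpha>\alpha^*$ and some constant $\beta\ge \frac{\sqrt2}{\sqrt2-1}$ with $$(1-1/\beta)\,\alpha\, e^{-\frac1\alpha(1+1/\beta)}>1,$$ we have $|L(v)|\ge \alpha\Delta(v)+\beta$ for every $v\in\mathcal{V}$. Then the infinite volume Gibbs measure (with the uniform specification) on the list colorings of $\mathcal{G}$ is unique.
   Context: $\Delta(v)$ is the degree of $v$ in $\mathcal{G}$. A valid list coloring of $\mathcal{G}$ (or of a set of vertices) assigns to each vertex $u$ a color $c(u)\in L(u)$ so that no two adjacent vertices have the same color. For a finite region $\Psi\subset\mathcal{V}$ and a coloring $C$ of $\mathcal{V}\setminus\Psi$, $\mu_\Psi^C$ denotes the uniform distribution on the valid list colorings of $\Psi$ in which no vertex of $\Psi$ has the same color as an adjacent vertex colored by $C$. A probability measure $\mu$ on the set of all valid list colorings of $\mathcal{G}$ is called an infinite volume Gibbs measure with the uniform specification if, for any finite region $\Psi$, the distribution induced on $\Psi$ by $\mu$ conditioned on any coloring $C$ of the vertices $\mathcal{V}\setminus\Psi$ is $\mu_\Psi^C$. *)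

theory Defs
  imports "HOL-Probability.Probability"
begin

definition simple_graph :: "'v set \<Rightarrow> 'v set set \<Rightarrow> bool" where
  "simple_graph V E \<longleftrightarrow> (\<forall>e\<in>E. \<exists>u\<in>V. \<exists>v\<in>V. u \<noteq> v \<and> e = {u, v})"

definition triangle_free :: "'v set set \<Rightarrow> bool" where
  "triangle_free E \<longleftrightarrow> \<not> (\<exists>u v w. {u, v} \<in> E \<and> {v, w} \<in> E \<and> {u, w} \<in> E)"

definition neighbours :: "'v set set \<Rightarrow> 'v \<Rightarrow> 'v set" where
  "neighbours E v = {u. {u, v} \<in> E}"

definition vertex_degree :: "'v set set \<Rightarrow> 'v \<Rightarrow> nat" where
  "vertex_degree E v = card (neighbours E v)"

text \<open>Local finiteness is required explicitly, since \<open>card\<close> is 0 on infinite sets.\<close>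

definition has_max_degree :: "'v set \<Rightarrow> 'v set set \<Rightarrow> nat \<Rightarrow> bool" where
  "has_max_degree V E D \<longleftrightarrow>
     (\<forall>v\<in>V. finite (neighbours E v) \<and> vertex_degree E v \<le> D) \<and> (\<exists>v\<in>V. vertex_degree E v = D)"

text \<open>Colorings of \<open>U\<close> are extensional functions, i.e. \<open>undefined\<close> outside \<open>U\<close>.\<close>

definition list_colorings :: "'v set set \<Rightarrow> ('v \<Rightarrow> nat set) \<Rightarrow> 'v set \<Rightarrow> ('v \<Rightarrow> nat) set" where
  "list_colorings E L U =
     {c \<in> (\<Pi>\<^sub>E u\<in>U. L u). \<forall>u\<in>U. \<forall>v\<in>U. {u, v} \<in> E \<longrightarrow> c u \<noteq> c v}"

definition compatible_colorings ::
  "'v set \<Rightarrow> 'v set set \<Rightarrow> ('v \<Rightarrow> nat set) \<Rightarrow> 'v set \<Rightarrow> ('v \<Rightarrow> nat) \<Rightarrow> ('v \<Rightarrow> nat) set" where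
  "compatible_colorings V E L \<Psi> C =
     {c \<in> list_colorings E L \<Psi>. \<forall>u\<in>\<Psi>. \<forall>w\<in>V - \<Psi>. {u, w} \<in> E \<longrightarrow> c u \<noteq> C w}"

text \<open>The uniform specification \<open>\<mu>\<^sub>\<Psi>\<^sup>C\<close>. It is meaningful only if
  \<open>compatible_colorings V E L \<Psi> C\<close> is finite and non-empty; this holds for finite \<open>\<Psi>\<close> as soon as
  every list is finite and longer than the degree of its vertex.\<close>

definition uniform_spec ::
  "'v set \<Rightarrow> 'v set set \<Rightarrow> ('v \<Rightarrow> nat set) \<Rightarrow> 'v set \<Rightarrow> ('v \<Rightarrow> nat) \<Rightarrow> ('v \<Rightarrow> nat) pmf" where
  "uniform_spec V E L \<Psi> C = pmf_of_set (compatible_colorings V E L \<Psi> C)"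

text \<open>The set of all valid list colorings, with the \<open>\<sigma>\<close>-algebra generated by the
  color maps \<open>\<lambda>\<omega>. \<omega> v\<close>. Only \<open>space\<close> and \<open>sets\<close> of this measure are used.\<close>

definition coloring_space :: "'v set \<Rightarrow> 'v set set \<Rightarrow> ('v \<Rightarrow> nat set) \<Rightarrow> ('v \<Rightarrow> nat) measure" where
  "coloring_space V E L =
     restrict_space (\<Pi>\<^sub>M v\<in>V. count_space (L v)) (list_colorings E L V)"

text \<open>The \<open>\<sigma>\<close>-algebra on the valid list colorings generated by the coloring outside \<open>\<Psi>\<close>.\<close>

definition outside_algebra ::
  "'v set \<Rightarrow> 'v set set \<Rightarrow> ('v \<Rightarrow> nat set) \<Rightarrow> 'v set \<Rightarrow> ('v \<Rightarrow> nat) measure" where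
  "outside_algebra V E L \<Psi> =
     vimage_algebra (list_colorings E L V) (\<lambda>\<omega>. restrict \<omega> (V - \<Psi>))
       (\<Pi>\<^sub>M v\<in>V - \<Psi>. count_space (L v))"

text \<open>A single coloring of \<open>V - \<Psi>\<close> typically has probability 0, so conditioning on it is
  understood in the sense of regular conditional probabilities: for almost every \<open>\<omega>\<close>, the conditional
  probability that the coloring of \<open>\<Psi>\<close> is \<open>\<xi>\<close>, given the coloring outside \<open>\<Psi>\<close>, is the weight of \<open>\<xi>\<close>
  under \<open>\<mu>\<^sub>\<Psi>\<^sup>C\<close> with \<open>C = restrict \<omega> (V - \<Psi>)\<close>.\<close>

definition gibbs_measure ::
  "'v set \<Rightarrow> 'v set set \<Rightarrow> ('v \<Rightarrow> nat set) \<Rightarrow> ('v \<Rightarrow> nat) measure \<Rightarrow> bool" where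
  "gibbs_measure V E L \<mu> \<longleftrightarrow>
     prob_space \<mu> \<and> sets \<mu> = sets (coloring_space V E L) \<and>
     (\<forall>\<Psi>. finite \<Psi> \<and> \<Psi> \<subseteq> V \<longrightarrow>
        (\<forall>\<xi>\<in>list_colorings E L \<Psi>. AE \<omega> in \<mu>.
           real_cond_exp \<mu> (outside_algebra V E L \<Psi>)
             (indicator {\<omega>' \<in> space \<mu>. restrict \<omega>' \<Psi> = \<xi>}) \<omega>
           = pmf (uniform_spec V E L \<Psi> (restrict \<omega> (V - \<Psi>))) \<xi>))"

lemma space_coloring_space: "space (coloring_space V E L) = list_colorings E L V"
  by (auto simp: coloring_space_def space_restrict_space space_PiM list_colorings_def)

lemma subalgebra_outside_algebra:
  assumes "sets \<mu> = sets (coloring_space V E L)"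
  shows "subalgebra \<mu> (outside_algebra V E L \<Psi>)"
proof -
  have sp: "space \<mu> = list_colorings E L V"
    using sets_eq_imp_space_eq[OF assms] by (simp add: space_coloring_space)
  have "(\<lambda>\<omega>. restrict \<omega> (V - \<Psi>)) \<in>
      coloring_space V E L \<rightarrow>\<^sub>M (\<Pi>\<^sub>M v\<in>V - \<Psi>. count_space (L v))"
    unfolding coloring_space_def
    by (rule measurable_restrict_space1, rule measurable_restrict_subset) auto
  hence "(\<lambda>\<omega>. restrict \<omega> (V - \<Psi>)) \<in> \<mu> \<rightarrow>\<^sub>M (\<Pi>\<^sub>M v\<in>V - \<Psi>. count_space (L v))"
    using measurable_cong_sets[OF assms refl] by blast
  from measurable_sets[OF this] have "sets (outside_algebra V E L \<Psi>) \<subseteq> sets \<mu>"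
    unfolding outside_algebra_def sp[symmetric]
    using measurable_space[OF \<open>_ \<in> \<mu> \<rightarrow>\<^sub>M _\<close>] by (subst sets_vimage_algebra2) auto
  thus ?thesis by (simp add: subalgebra_def outside_algebra_def sp)
qed

definition alpha_star :: real where
  "alpha_star = (THE x. x * exp (- 1 / x) = 1)"

lemma alpha_star_unique: "\<exists>!x::real. x * exp (- 1 / x) = 1"
proof -
  have pos: "x > 0" if "x * exp (- 1 / x) = 1" for x :: real
    using that by (metis exp_gt_zero zero_less_mult_pos2 zero_less_one)
  have mono: "x * exp (- 1 / x) < y * exp (- 1 / y)" if "0 < x" "x < y" for x y :: real
    using that by (intro mult_strict_mono) (auto simp: field_simps)
  have "\<exists>x\<ge>1. x \<le> exp 1 \<and> x * exp (- 1 / x) = (1::real)"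
  proof (rule IVT')
    have "exp 1 * exp (- 1 / exp 1) = exp (1 + - 1 / exp (1::real))"
      by (simp only: exp_add)
    thus "1 \<le> exp 1 * exp (- 1 / exp (1::real))" by simp
  qed (auto intro!: continuous_intros)
  thus ?thesis using pos mono by (metis less_irrefl linorder_neqE)
qed

end

theory Submission
  imports Defs
begin

text \<open>
  Coloring \<open>v\<close> with \<open>a\<close> amounts to deleting \<open>v\<close> and removing \<open>a\<close> from the lists of its neighbors;
  since \<open>\<alpha> \<ge> 1\<close>, this preserves \<open>|L(u)| \<ge> \<alpha> \<Delta>(u) + \<beta>\<close>, with degrees taken in the remaining region.
  So bounds on marginals may be proved after revealing the colors of other vertices. Revealing all
  of them gives the bound \<open>1 / \<beta>\<close>; revealing all but the neighbors of \<open>v\<close>, which are independent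
  because there are no triangles, gives \<open>1 / (\<kappa> \<Delta>(v))\<close> with \<open>\<kappa> = \<alpha> exp (- (1 + 1/\<beta>) / \<alpha>)\<close>.

  For two families of lists that differ only far away from \<open>v\<close>, consider the oscillation over the
  colors of the logarithm of the ratio of the marginals at \<open>v\<close>. Writing ratios of counts as
  telescoping products over the neighbors of \<open>v\<close> bounds it by a sum over the neighbors \<open>x\<close> of their
  oscillations times \<open>p / (1 - p)\<close>, where \<open>p\<close> bounds the marginals at \<open>x\<close>. Measured per unit of
  degree, it therefore contracts by \<open>\<rho> = 1 / ((1 - 1/\<beta>) \<kappa>) < 1\<close> at each step, and the influence of
  the boundary decays exponentially.

  Decay makes the finite-volume probabilities of local events converge. The limit is countably
  additive because a decreasing sequence of non-empty local events has non-empty intersection by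
  compactness; this works directly on the valid colorings, even if there are uncountably many
  vertices and these do not form a measurable subset of the product space. Every Gibbs measure
  averages finite-volume probabilities, so decay also forces any two of them to agree on local events.
\<close>

section \<open>Counting list colorings\<close>

definition forbid :: "'v set set \<Rightarrow> 'v \<Rightarrow> nat \<Rightarrow> ('v \<Rightarrow> nat set) \<Rightarrow> 'v \<Rightarrow> nat set" where
  "forbid E v a L = (\<lambda>u. if {u, v} \<in> E then L u - {a} else L u)"

text \<open>Self-reducibility of the counting problem: once \<open>v\<close> has color
  \<open>a\<close>, the edges at \<open>v\<close> say exactly that its neighbors avoid
  \<open>a\<close>, and this can be moved into their lists. The vertex \<open>v\<close> itself then
  drops out of the region.\<close>

lemma list_colorings_fix:
  assumes "v \<in> U" "{v} \<notin> E" "a \<in> L v"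
  shows "{c \<in> list_colorings E L U. c v = a} =
    (\<lambda>c. c(v := a)) ` list_colorings E (forbid E v a L) (U - {v})"
proof (intro equalityI subsetI)
  fix c assume "c \<in> {c \<in> list_colorings E L U. c v = a}"
  hence c: "c \<in> list_colorings E L U" "c v = a" by auto
  have "c(v := undefined) \<in> list_colorings E (forbid E v a L) (U - {v})"
    using c assms unfolding list_colorings_def forbid_def PiE_iff extensional_def
    by (auto simp: insert_commute)
  moreover have "c = (c(v := undefined))(v := a)" using c by auto
  ultimately show "c \<in> (\<lambda>c. c(v := a)) ` list_colorings E (forbid E v a L) (U - {v})" by blast
next
  fix c assume "c \<in> (\<lambda>c. c(v := a)) ` list_colorings E (forbid E v a L) (U - {v})"
  then obtain d where d: "d \<in> list_colorings E (forbid E v a L) (U - {v})" "c = d(v := a)" by auto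
  have dl: "d u \<in> L u" if "u \<in> U" "u \<noteq> v" for u
    using d(1) that unfolding list_colorings_def forbid_def PiE_iff by (auto split: if_splits)
  have dn: "d u \<noteq> a" if "u \<in> U" "u \<noteq> v" "{u, v} \<in> E" for u
    using d(1) that unfolding list_colorings_def forbid_def PiE_iff by (auto split: if_splits)
  have dd: "d u \<noteq> d w" if "u \<in> U - {v}" "w \<in> U - {v}" "{u, w} \<in> E" for u w
    using d(1) that unfolding list_colorings_def by auto
  have "c u \<noteq> c w" if "u \<in> U" "w \<in> U" "{u, w} \<in> E" for u w
    using dn[of u] dn[of w] dd[of u w] that assms(2) d(2) by (auto simp: insert_commute)
  moreover have "c u \<in> L u" if "u \<in> U" for u using dl[of u] that assms d(2) by auto
  moreover have "c u = undefined" if "u \<notin> U" for u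
    using d assms that unfolding list_colorings_def by (auto simp: PiE_iff extensional_def)
  ultimately show "c \<in> {c \<in> list_colorings E L U. c v = a}"
    using d(2) unfolding list_colorings_def by (auto simp: PiE_iff extensional_def)
qed

lemma card_list_colorings_fix:
  assumes "v \<in> S" "v \<in> U" "{v} \<notin> E" "\<xi> v \<in> L v"
  shows "card {c \<in> list_colorings E L U. \<forall>s\<in>S. c s = \<xi> s} =
    card {c \<in> list_colorings E (forbid E v (\<xi> v) L) (U - {v}). \<forall>s\<in>S - {v}. c s = \<xi> s}"
proof -
  let ?M = "{c \<in> list_colorings E (forbid E v (\<xi> v) L) (U - {v}). \<forall>s\<in>S - {v}. c s = \<xi> s}"
  have "{c \<in> list_colorings E L U. \<forall>s\<in>S. c s = \<xi> s} =
      {c \<in> {c \<in> list_colorings E L U. c v = \<xi> v}. \<forall>s\<in>S - {v}. c s = \<xi> s}"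
    using assms(1) by auto
  also have "\<dots> = (\<lambda>c. c(v := \<xi> v)) ` ?M"
    unfolding list_colorings_fix[of v U E "\<xi> v" L, OF assms(2-4)] by (auto split: if_splits)
  finally have "card {c \<in> list_colorings E L U. \<forall>s\<in>S. c s = \<xi> s} =
      card ((\<lambda>c. c(v := \<xi> v)) ` ?M)" by simp
  moreover have "inj_on (\<lambda>c. c(v := \<xi> v)) ?M"
  proof (rule inj_onI)
    fix c d assume "c \<in> ?M" "d \<in> ?M" and eq: "c(v := \<xi> v) = d(v := \<xi> v)"
    \<comment> \<open>Extensionality on \<open>U - {v}\<close> pins the value at \<open>v\<close>,
      so overwriting it loses no information.\<close>
    hence "c v = undefined" "d v = undefined"
      by (auto simp: list_colorings_def PiE_iff extensional_def)
    thus "c = d" using eq by (metis fun_upd_triv fun_upd_upd)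
  qed
  ultimately show ?thesis by (simp add: card_image)
qed

lemma finite_list_colorings:
  assumes "finite U" "\<And>u. u \<in> U \<Longrightarrow> finite (L u)"
  shows "finite (list_colorings E L U)"
  by (rule finite_subset[OF _ finite_PiE[OF assms]]) (auto simp: list_colorings_def)

lemma list_colorings_cong:
  assumes "\<And>u. u \<in> U \<Longrightarrow> L u = L' u"
  shows "list_colorings E L U = list_colorings E L' U"
proof -
  have "(\<Pi>\<^sub>E u\<in>U. L u) = (\<Pi>\<^sub>E u\<in>U. L' u)" using assms by (intro PiE_cong) auto
  thus ?thesis unfolding list_colorings_def by simp
qed

section \<open>Partition functions under deletion of vertices\<close>

text \<open>Only the edges and the constants are fixed. Region and lists remain parameters, because
  the inductions delete vertices and shrink lists while the inequalities on \<alpha> and \<beta>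
  stay the same.\<close>

locale sparse_lists =
  fixes E :: "'v set set" and \<alpha> \<beta> :: real
  assumes loopless: "{v} \<notin> E"
    and triangle_free: "triangle_free E"
    and alpha_ge_1: "\<alpha> \<ge> 1"
    and beta_gt_1: "\<beta> > 1"
    and contraction: "(1 - 1 / \<beta>) * \<alpha> * exp (- (1 / \<alpha>) * (1 + 1 / \<beta>)) > 1"
begin

definition nbs :: "'v set \<Rightarrow> 'v \<Rightarrow> 'v set" where
  "nbs U u = {w \<in> U. {u, w} \<in> E}"

definition admissible :: "'v set \<Rightarrow> ('v \<Rightarrow> nat set) \<Rightarrow> bool" where
  "admissible U L \<longleftrightarrow> finite U \<and>
     (\<forall>u\<in>U. finite (L u) \<and> \<alpha> * real (card (nbs U u)) + \<beta> \<le> real (card (L u)))"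

definition Z :: "'v set \<Rightarrow> ('v \<Rightarrow> nat set) \<Rightarrow> real" where
  "Z U L = real (card (list_colorings E L U))"

text \<open>The number of colorings of \<open>U\<close> that give color \<open>j\<close> to \<open>v \<in> U\<close>, expressed through
  \<open>U - {v}\<close>, so that every marginal is a ratio of two values of \<open>Z\<close>.\<close>

definition Zc :: "'v set \<Rightarrow> ('v \<Rightarrow> nat set) \<Rightarrow> 'v \<Rightarrow> nat \<Rightarrow> real" where
  "Zc U L v j = (if j \<in> L v then Z (U - {v}) (forbid E v j L) else 0)"

definition marginal :: "'v set \<Rightarrow> ('v \<Rightarrow> nat set) \<Rightarrow> 'v \<Rightarrow> nat \<Rightarrow> real" where
  "marginal U L v j = Zc U L v j / Z U L"

definition kappa :: real where
  "kappa = \<alpha> * exp (- (1 / \<alpha>) * (1 + 1 / \<beta>))"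

definition rho :: real where
  "rho = 1 / ((1 - 1 / \<beta>) * kappa)"

lemma kappa_pos: "kappa > 0"
  using alpha_ge_1 by (simp add: kappa_def)

lemma rho_pos: "rho > 0" and rho_less_1: "rho < 1"
  using contraction kappa_pos beta_gt_1 unfolding rho_def kappa_def by (auto simp: mult.assoc)

lemma finite_nbs: "finite U \<Longrightarrow> finite (nbs U u)"
  by (simp add: nbs_def)

lemma nbs_diff: "nbs (U - {v}) u = nbs U u - {v}"
  by (auto simp: nbs_def)

lemma Z_cong: "(\<And>u. u \<in> U \<Longrightarrow> L u = L' u) \<Longrightarrow> Z U L = Z U L'"
  unfolding Z_def by (subst list_colorings_cong[of U L L']) auto

lemma Z_empty: "Z {} L = 1"
  by (simp add: Z_def list_colorings_def)

lemma Z_nonneg: "Z U L \<ge> 0"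
  by (simp add: Z_def)

lemma Zc_nonneg: "Zc U L v j \<ge> 0"
  by (simp add: Zc_def Z_nonneg)

lemma Z_eq_sum_Zc:
  assumes "finite U" "\<And>u. u \<in> U \<Longrightarrow> finite (L u)" "v \<in> U"
  shows "Z U L = (\<Sum>a\<in>L v. Zc U L v a)"
proof -
  have fin: "finite (list_colorings E L U)" using finite_list_colorings[of U L E] assms by auto
  have "list_colorings E L U = (\<Union>a\<in>L v. {c \<in> list_colorings E L U. c v = a})"
    using assms(3) by (auto simp: list_colorings_def PiE_iff)
  hence "card (list_colorings E L U) = card (\<Union>a\<in>L v. {c \<in> list_colorings E L U. c v = a})"
    by simp
  also have "\<dots> = (\<Sum>a\<in>L v. card {c \<in> list_colorings E L U. c v = a})"
    using assms fin by (intro card_UN_disjoint) auto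
  also have "\<dots> = (\<Sum>a\<in>L v. card (list_colorings E (forbid E v a L) (U - {v})))"
  proof (rule sum.cong)
    fix a assume "a \<in> L v"
    from card_list_colorings_fix[of v "{v}" U E "\<lambda>_. a" L] this
    show "card {c \<in> list_colorings E L U. c v = a} =
        card (list_colorings E (forbid E v a L) (U - {v}))"
      using assms(3) loopless by simp
  qed simp
  finally show ?thesis by (simp add: Z_def Zc_def)
qed

lemma forbid_commute: "forbid E v a (forbid E w b L) = forbid E w b (forbid E v a L)"
  by (auto simp: forbid_def fun_eq_iff)

lemma finite_forbid: "finite (L u) \<Longrightarrow> finite (forbid E v a L u)"
  by (simp add: forbid_def)

text \<open>Conditioning on the color of \<open>x\<close>, written with unnormalized counts.
  Inequalities linear in \<open>Zc\<close> and \<open>Z\<close> can then be summed over the colors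
  of \<open>x\<close> without any division.\<close>

lemma Zc_peel:
  assumes "finite U" "\<And>u. u \<in> U \<Longrightarrow> finite (L u)" "v \<in> U" "x \<in> U" "x \<noteq> v"
  shows "Zc U L v j = (\<Sum>a\<in>L x. Zc (U - {x}) (forbid E x a L) v j)"
proof (cases "j \<in> L v")
  case True
  have "Zc U L v j = (\<Sum>a\<in>forbid E v j L x. Z (U - {v} - {x}) (forbid E x a (forbid E v j L)))"
    using Z_eq_sum_Zc[of "U - {v}" "forbid E v j L" x] assms True
    by (simp add: Zc_def finite_forbid cong: sum.cong)
  also have "\<dots> = (\<Sum>a\<in>L x. Zc (U - {x}) (forbid E x a L) v j)"
  proof (rule sum.mono_neutral_cong_left)
    show "finite (L x)" using assms by auto
    show "forbid E v j L x \<subseteq> L x" by (auto simp: forbid_def)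
    show "\<forall>a\<in>L x - forbid E v j L x. Zc (U - {x}) (forbid E x a L) v j = 0"
      by (auto simp: forbid_def Zc_def insert_commute split: if_splits)
    fix a assume "a \<in> forbid E v j L x"
    hence "j \<in> forbid E x a L v" using True by (auto simp: forbid_def insert_commute split: if_splits)
    moreover have "U - {x} - {v} = U - {v} - {x}" by auto
    ultimately show "Z (U - {v} - {x}) (forbid E x a (forbid E v j L)) =
        Zc (U - {x}) (forbid E x a L) v j"
      by (simp add: Zc_def forbid_commute[of v j x a])
  qed
  finally show ?thesis .
next
  case False
  thus ?thesis by (auto simp: Zc_def forbid_def intro!: sum.neutral)
qed

text \<open>Deleting \<open>v\<close> lowers the degree of each neighbor by one, hence the required
  list size by \<alpha>, and \<alpha> \<ge> 1 pays for one lost color. The new lists are left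
  general so that this covers both \<open>forbid\<close> and the lists used for telescoping.\<close>

lemma admissible_diff:
  assumes "admissible U L"
    and "\<And>u. u \<in> U - {v} \<Longrightarrow> finite (L' u)"
    and "\<And>u. u \<in> U - {v} \<Longrightarrow> {u, v} \<notin> E \<Longrightarrow> L' u = L u"
    and "\<And>u. u \<in> U - {v} \<Longrightarrow> {u, v} \<in> E \<Longrightarrow> card (L u) \<le> card (L' u) + 1"
    and "v \<in> U"
  shows "admissible (U - {v}) L'"
  unfolding admissible_def
proof (intro conjI ballI)
  show "finite (U - {v})" using assms(1) by (simp add: admissible_def)
  fix u assume u: "u \<in> U - {v}"
  show "finite (L' u)" using assms(2) u by simp
  have fin: "finite (nbs U u)" using assms(1) by (simp add: admissible_def nbs_def)
  have ge: "\<alpha> * real (card (nbs U u)) + \<beta> \<le> real (card (L u))"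
    using assms(1) u by (auto simp: admissible_def)
  show "\<alpha> * real (card (nbs (U - {v}) u)) + \<beta> \<le> real (card (L' u))"
  proof (cases "{u, v} \<in> E")
    case False
    hence "nbs (U - {v}) u = nbs U u" by (auto simp: nbs_def)
    thus ?thesis using ge assms(3)[OF u False] by simp
  next
    case True
    hence "v \<in> nbs U u" using assms(5) by (simp add: nbs_def)
    hence "card (nbs U u) = card (nbs (U - {v}) u) + 1"
      using fin by (simp add: nbs_diff card_Suc_Diff1 del: card_Diff_insert)
    moreover have "real (card (L u)) \<le> real (card (L' u)) + 1"
      using assms(4)[OF u True] by linarith
    ultimately show ?thesis using ge alpha_ge_1 by (simp add: algebra_simps)
  qed
qed

lemma card_Diff_singleton_ge: "card A \<le> card (A - {a}) + 1"
  by (metis Suc_eq_plus1 card_Diff1_le card_Suc_Diff1 finite_insert insert_Diff_single card.infinite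
      finite_Diff2 Diff_empty Diff_insert0 le_add1 le_refl finite.emptyI)

lemma admissible_forbid:
  assumes "admissible U L" "v \<in> U"
  shows "admissible (U - {v}) (forbid E v a L)"
  by (rule admissible_diff[OF assms(1) _ _ _ assms(2)])
     (use assms(1) card_Diff_singleton_ge in \<open>auto simp: forbid_def admissible_def\<close>)

lemma admissible_finite: "admissible U L \<Longrightarrow> finite U"
  and admissible_finite_list: "admissible U L \<Longrightarrow> u \<in> U \<Longrightarrow> finite (L u)"
  and admissible_card: "admissible U L \<Longrightarrow> u \<in> U \<Longrightarrow>
     \<alpha> * real (card (nbs U u)) + \<beta> \<le> real (card (L u))"
  by (auto simp: admissible_def)

lemma admissible_card_ge_beta:
  assumes "admissible U L" "u \<in> U"
  shows "\<beta> \<le> real (card (L u))"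
proof -
  have "\<alpha> * real (card (nbs U u)) \<ge> 0" using alpha_ge_1 by simp
  thus ?thesis using admissible_card[OF assms] by linarith
qed

lemma admissible_nonempty:
  assumes "admissible U L" "u \<in> U"
  shows "L u \<noteq> {}"
  using admissible_card_ge_beta[OF assms] beta_gt_1 by auto

lemma Z_pos:
  assumes "admissible U L"
  shows "Z U L > 0"
  using admissible_finite[OF assms] assms
proof (induction U arbitrary: L rule: finite_psubset_induct)
  case (psubset U)
  show ?case
  proof (cases "U = {}")
    case True
    thus ?thesis by (simp add: Z_empty)
  next
    case False
    then obtain v where v: "v \<in> U" by auto
    have "Z (U - {v}) (forbid E v a L) > 0" for a
      using psubset.IH[of "U - {v}"] admissible_forbid[OF psubset.prems v] v by auto
    hence "(\<Sum>a\<in>L v. Zc U L v a) > 0"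
      using admissible_nonempty[OF psubset.prems v] admissible_finite_list[OF psubset.prems v]
      by (intro sum_pos) (auto simp: Zc_def)
    thus ?thesis
      using Z_eq_sum_Zc[of U L v] v psubset.hyps admissible_finite_list[OF psubset.prems] by simp
  qed
qed

lemma Zc_pos:
  assumes "admissible U L" "v \<in> U" "j \<in> L v"
  shows "Zc U L v j > 0"
  using Z_pos[OF admissible_forbid[OF assms(1,2)]] assms(3) by (simp add: Zc_def)

lemma marginal_pos:
  assumes "admissible U L" "v \<in> U" "j \<in> L v"
  shows "marginal U L v j > 0"
  using Zc_pos[OF assms] Z_pos[OF assms(1)] by (simp add: marginal_def)

lemma marginal_nonneg: "marginal U L v j \<ge> 0"
  by (simp add: marginal_def Z_nonneg Zc_nonneg)

lemma marginal_notin: "j \<notin> L v \<Longrightarrow> marginal U L v j = 0"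
  by (simp add: marginal_def Zc_def)

lemma sum_marginal:
  assumes "admissible U L" "v \<in> U"
  shows "(\<Sum>a\<in>L v. marginal U L v a) = 1"
  using Z_eq_sum_Zc[of U L v] assms Z_pos[OF assms(1)] admissible_finite[OF assms(1)]
    admissible_finite_list[OF assms(1)]
  by (simp add: marginal_def sum_divide_distrib[symmetric])

section \<open>Upper bounds on marginals\<close>

text \<open>Revealing a vertex that is neither \<open>v\<close> nor a neighbor of \<open>v\<close>
  leaves the degree of \<open>v\<close> unchanged, and the inequality sums over the revealed colors.
  Hence it need only be proved when the region is \<open>v\<close> with its neighbors.\<close>

lemma Zc_le_by_peeling:
  assumes star: "\<And>U L. admissible U L \<Longrightarrow> v \<in> U \<Longrightarrow> U \<subseteq> insert v (nbs U v) \<Longrightarrow>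
      c (card (nbs U v)) * Zc U L v j \<le> Z U L"
    and "admissible U L" "v \<in> U"
  shows "c (card (nbs U v)) * Zc U L v j \<le> Z U L"
  using admissible_finite[OF assms(2)] assms(2,3)
proof (induction U arbitrary: L rule: finite_psubset_induct)
  case (psubset U)
  show ?case
  proof (cases "U \<subseteq> insert v (nbs U v)")
    case True
    thus ?thesis using star psubset.prems by blast
  next
    case False
    then obtain x where x: "x \<in> U" "x \<noteq> v" "x \<notin> nbs U v" by auto
    note fin = psubset.hyps admissible_finite_list[OF psubset.prems(1)]
    have nbs: "nbs (U - {x}) v = nbs U v" using x by (auto simp: nbs_def)
    have "c (card (nbs U v)) * Zc U L v j =
        (\<Sum>a\<in>L x. c (card (nbs (U - {x}) v)) * Zc (U - {x}) (forbid E x a L) v j)"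
      using Zc_peel[OF fin psubset.prems(2) x(1,2)] by (simp add: sum_distrib_left nbs)
    also have "\<dots> \<le> (\<Sum>a\<in>L x. Z (U - {x}) (forbid E x a L))"
      using psubset.IH[of "U - {x}"] admissible_forbid[OF psubset.prems(1) x(1)] x psubset.prems(2)
      by (intro sum_mono) auto
    also have "\<dots> = Z U L" using Z_eq_sum_Zc[OF fin x(1)] by (simp add: Zc_def)
    finally show ?thesis .
  qed
qed

text \<open>Here the neighbors of \<open>v\<close> are revealed too. The degree of \<open>v\<close>
  shrinks, but the constant does not depend on it, and the induction ends with \<open>v\<close>
  alone, choosing uniformly from at least \<beta> colors.\<close>

lemma beta_Zc_le:
  assumes "admissible U L" "v \<in> U"
  shows "\<beta> * Zc U L v j \<le> Z U L"
  using admissible_finite[OF assms(1)] assms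
proof (induction U arbitrary: L rule: finite_psubset_induct)
  case (psubset U)
  note fin = psubset.hyps admissible_finite_list[OF psubset.prems(1)]
  show ?case
  proof (cases "U = {v}")
    case True
    have "Z {v} L = real (card (L v))"
      using Z_eq_sum_Zc[of "{v}" L v] fin True by (simp add: Zc_def Z_empty cong: sum.cong)
    moreover have "\<beta> * Zc {v} L v j \<le> \<beta>" using beta_gt_1 by (simp add: Zc_def Z_empty)
    ultimately show ?thesis using admissible_card_ge_beta[OF psubset.prems] True by simp
  next
    case False
    then obtain x where x: "x \<in> U" "x \<noteq> v" using psubset.prems by auto
    have "\<beta> * Zc U L v j = (\<Sum>a\<in>L x. \<beta> * Zc (U - {x}) (forbid E x a L) v j)"
      using Zc_peel[OF fin psubset.prems(2) x] by (simp add: sum_distrib_left)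
    also have "\<dots> \<le> (\<Sum>a\<in>L x. Z (U - {x}) (forbid E x a L))"
      using psubset.IH[of "U - {x}"] admissible_forbid[OF psubset.prems(1) x(1)] x psubset.prems(2)
      by (intro sum_mono) auto
    also have "\<dots> = Z U L" using Z_eq_sum_Zc[OF fin x(1)] by (simp add: Zc_def)
    finally show ?thesis .
  qed
qed

lemma Z_independent:
  assumes "finite N" "\<And>u. u \<in> N \<Longrightarrow> finite (L u)" "\<And>u w. u \<in> N \<Longrightarrow> w \<in> N \<Longrightarrow> {u, w} \<notin> E"
  shows "Z N L = (\<Prod>u\<in>N. real (card (L u)))"
  using assms
proof (induction N)
  case empty
  thus ?case by (simp add: Z_empty)
next
  case (insert x N)
  have "Z (insert x N) L = (\<Sum>a\<in>L x. Z N (forbid E x a L))"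
    using Z_eq_sum_Zc[of "insert x N" L x] insert by (simp add: Zc_def cong: sum.cong)
  also have "\<dots> = (\<Sum>a\<in>L x. Z N L)"
    using insert.prems by (intro sum.cong Z_cong) (auto simp: forbid_def)
  also have "\<dots> = (\<Prod>u\<in>insert x N. real (card (L u)))"
    using insert by simp
  finally show ?case .
qed

text \<open>The reciprocal of \<open>1 + x \<le> exp x\<close> at \<open>x = 1 / (l - 1)\<close>. It
  lets a product of avoidance probabilities be replaced by the exponential of a sum.\<close>

lemma exp_le_one_minus_inverse:
  fixes l :: real
  assumes "l > 1"
  shows "exp (- 1 / (l - 1)) \<le> 1 - 1 / l"
proof -
  have "exp (1 / (l - 1)) \<ge> 1 + 1 / (l - 1)" by (rule exp_ge_add_one_self)
  moreover have "1 + 1 / (l - 1) = 1 / (1 - 1 / l)" using assms by (simp add: field_simps)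
  ultimately have "exp (1 / (l - 1)) \<ge> 1 / (1 - 1 / l)" by simp
  moreover have "1 - 1 / l > 0" using assms by simp
  ultimately have "1 / exp (1 / (l - 1)) \<le> 1 - 1 / l"
    by (simp add: field_simps)
  thus ?thesis by (simp add: exp_minus field_simps)
qed

text \<open>The tangent of \<open>exp\<close> at \<open>-(1 + 1/\<beta>) / \<alpha>\<close> replaces the arithmetic-geometric mean
  inequality here.\<close>

lemma sum_prod_avoid_ge:
  fixes M :: "'v \<Rightarrow> nat set"
  assumes "finite A" "finite N" "\<And>i. i \<in> N \<Longrightarrow> finite (M i)"
    and M: "\<And>i. i \<in> N \<Longrightarrow> \<beta> + 1 \<le> real (card (M i))"
    and A: "\<alpha> * real (card N) \<le> real (card A)"
  shows "kappa * real (card N) * (\<Prod>i\<in>N. real (card (M i)))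
    \<le> (\<Sum>k\<in>A. \<Prod>i\<in>N. real (card (M i - {k})))"
proof -
  let ?l = "\<lambda>i. real (card (M i))"
  \<comment> \<open>\<open>exp (y k)\<close> is a lower bound for the probability that independent
    uniform choices from the lists \<open>M i\<close> all avoid \<open>k\<close>.\<close>
  define y where "y k = (\<Sum>i\<in>N. if k \<in> M i then - 1 / (?l i - 1) else 0)" for k
  define a where "a = - (1 / \<alpha>) * (1 + 1 / \<beta>)"
  let ?P = "\<Prod>i\<in>N. ?l i"
  have l: "?l i > 1" if "i \<in> N" for i using M[OF that] beta_gt_1 by linarith
  have P: "?P \<ge> 0" by (intro prod_nonneg) auto
  have 1: "?P * exp (y k) \<le> (\<Prod>i\<in>N. real (card (M i - {k})))" for k
  proof -
    have "?P * exp (y k) = (\<Prod>i\<in>N. ?l i * exp (if k \<in> M i then - 1 / (?l i - 1) else 0))"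
      using assms(2) by (simp add: y_def exp_sum prod.distrib)
    also have "\<dots> \<le> (\<Prod>i\<in>N. real (card (M i - {k})))"
    proof (rule prod_mono, intro conjI)
      fix i assume i: "i \<in> N"
      show "0 \<le> ?l i * exp (if k \<in> M i then - 1 / (?l i - 1) else 0)" by simp
      show "?l i * exp (if k \<in> M i then - 1 / (?l i - 1) else 0) \<le> real (card (M i - {k}))"
      proof (cases "k \<in> M i")
        case True
        have "?l i * exp (- 1 / (?l i - 1)) \<le> ?l i * (1 - 1 / ?l i)"
          using exp_le_one_minus_inverse[OF l[OF i]] by (intro mult_left_mono) auto
        also have "\<dots> = ?l i - 1" using l[OF i] by (simp add: field_simps)
        also have "\<dots> = real (card (M i - {k}))"
          using True l[OF i] assms(3)[OF i] by (simp add: card_Diff_singleton of_nat_diff)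
        finally show ?thesis using True by simp
      qed simp
    qed
    finally show ?thesis .
  qed
  have 2: "exp (y k) \<ge> exp a * (1 + y k - a)" for k
    using mult_left_mono[OF exp_ge_add_one_self[of "y k - a"], of "exp a"]
    by (simp add: exp_diff add_diff_eq)
  have "(\<Sum>k\<in>A. y k) = (\<Sum>i\<in>N. \<Sum>k\<in>A. if k \<in> M i then - 1 / (?l i - 1) else 0)"
    unfolding y_def by (rule sum.swap)
  also have "\<dots> = (\<Sum>i\<in>N. - (real (card (A \<inter> M i)) / (?l i - 1)))"
    using assms(1) by (intro sum.cong) (auto simp: sum.If_cases Int_def)
  \<comment> \<open>The list \<open>M i\<close>, of size \<open>l\<close>, meets \<open>A\<close> in
    at most \<open>l\<close> colors, each costing \<open>1 / (l - 1)\<close>; the total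
    \<open>l / (l - 1)\<close> is at most \<open>1 + 1 / \<beta>\<close> because
    \<open>l \<ge> \<beta> + 1\<close>.\<close>
  also have "\<dots> \<ge> (\<Sum>i\<in>N. - (1 + 1 / \<beta>))"
  proof (rule sum_mono)
    fix i assume i: "i \<in> N"
    have "real (card (A \<inter> M i)) \<le> ?l i" using assms(3)[OF i] by (simp add: card_mono)
    hence "real (card (A \<inter> M i)) / (?l i - 1) \<le> ?l i / (?l i - 1)"
      using l[OF i] by (simp add: divide_right_mono)
    also have "\<dots> = 1 + 1 / (?l i - 1)" using l[OF i] by (simp add: field_simps)
    also have "\<dots> \<le> 1 + 1 / \<beta>"
      using M[OF i] beta_gt_1 by (intro add_left_mono divide_left_mono) auto
    finally show "- (1 + 1 / \<beta>) \<le> - (real (card (A \<inter> M i)) / (?l i - 1))" by simp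
  qed
  finally have 3: "(\<Sum>k\<in>A. y k) \<ge> - (real (card N) * (1 + 1 / \<beta>))"
    by (simp add: algebra_simps)
  have "real (card N) * (1 + 1 / \<beta>) \<le> (real (card A) / \<alpha>) * (1 + 1 / \<beta>)"
    using A alpha_ge_1 beta_gt_1 by (intro mult_right_mono) (auto simp: field_simps)
  also have "\<dots> = - a * real (card A)" by (simp add: a_def)
  finally have 4: "real (card A) \<le> (\<Sum>k\<in>A. 1 + y k - a)"
    using 3 by (simp add: sum.distrib sum_subtractf algebra_simps)
  have "kappa * real (card N) \<le> exp a * real (card A)"
    using mult_left_mono[OF A, of "exp a"] by (simp add: kappa_def a_def algebra_simps)
  also have "\<dots> \<le> exp a * (\<Sum>k\<in>A. 1 + y k - a)" using 4 by simp
  also have "\<dots> \<le> (\<Sum>k\<in>A. exp (y k))"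
    unfolding sum_distrib_left using 2 by (intro sum_mono) auto
  finally have "kappa * real (card N) * ?P \<le> (\<Sum>k\<in>A. exp (y k)) * ?P"
    using P by (rule mult_right_mono)
  also have "\<dots> = (\<Sum>k\<in>A. ?P * exp (y k))" by (simp add: sum_distrib_right mult.commute)
  also have "\<dots> \<le> (\<Sum>k\<in>A. \<Prod>i\<in>N. real (card (M i - {k})))"
    using 1 by (intro sum_mono) auto
  finally show ?thesis .
qed

text \<open>In a star without triangles the neighbors are independent, so after fixing the color of
  \<open>v\<close> the count factorizes. One color at \<open>v\<close> allows at most the full
  product of list sizes, and \<open>sum_prod_avoid_ge\<close> compares this with the sum over all
  colors.\<close>

lemma kappa_Zc_le:
  assumes "admissible U L" "v \<in> U"
  shows "kappa * real (card (nbs U v)) * Zc U L v j \<le> Z U L"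
proof (rule Zc_le_by_peeling[where c = "\<lambda>d. kappa * real d", OF _ assms])
  fix U and L :: "'v \<Rightarrow> nat set"
  assume adm: "admissible U L" and v: "v \<in> U" and star: "U \<subseteq> insert v (nbs U v)"
  let ?N = "nbs U v"
  have N: "U - {v} = ?N" using star v loopless by (auto simp: nbs_def)
  have finN: "finite ?N" using admissible_finite[OF adm] by (rule finite_nbs)
  have indep: "{u, w} \<notin> E" if "u \<in> ?N" "w \<in> ?N" for u w
    using that triangle_free unfolding triangle_free_def nbs_def by (auto simp: insert_commute)
  have sub: "?N \<subseteq> U" by (auto simp: nbs_def)
  have fin: "finite (L u)" if "u \<in> ?N" for u using that sub admissible_finite_list[OF adm] by auto
  have Z_forbid: "Z (U - {v}) (forbid E v k L) = (\<Prod>i\<in>?N. real (card (L i - {k})))" for k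
  proof -
    have "Z ?N (forbid E v k L) = (\<Prod>i\<in>?N. real (card (forbid E v k L i)))"
      using finN fin indep by (intro Z_independent finite_forbid) auto
    also have "\<dots> = (\<Prod>i\<in>?N. real (card (L i - {k})))"
      by (intro prod.cong) (auto simp: forbid_def nbs_def insert_commute)
    finally show ?thesis using N by simp
  qed
  have "Zc U L v j \<le> (\<Prod>i\<in>?N. real (card (L i)))"
    unfolding Zc_def Z_forbid using fin
    by (auto intro!: prod_mono prod_nonneg card_mono)
  hence "kappa * real (card ?N) * Zc U L v j \<le> kappa * real (card ?N) * (\<Prod>i\<in>?N. real (card (L i)))"
    using kappa_pos by (intro mult_left_mono) auto
  also have "\<dots> \<le> (\<Sum>k\<in>L v. \<Prod>i\<in>?N. real (card (L i - {k})))"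
  proof (rule sum_prod_avoid_ge)
    show "finite (L v)" using admissible_finite_list[OF adm v] .
    show "\<alpha> * real (card ?N) \<le> real (card (L v))"
      using admissible_card[OF adm v] beta_gt_1 by linarith
    \<comment> \<open>A neighbor of \<open>v\<close> has degree at least 1 because of
      \<open>v\<close> itself, hence at least \<alpha> + \<beta> \<ge> \<beta> + 1 colors.\<close>
    fix i assume i: "i \<in> ?N"
    hence "v \<in> nbs U i" using v by (simp add: nbs_def insert_commute)
    hence "card (nbs U i) \<noteq> 0" using finite_nbs[OF admissible_finite[OF adm]] by auto
    hence "\<alpha> * real (card (nbs U i)) \<ge> 1 * 1"
      using alpha_ge_1 by (intro mult_mono) auto
    thus "\<beta> + 1 \<le> real (card (L i))" using admissible_card[OF adm, of i] i sub by auto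
  qed (use finN fin in auto)
  also have "\<dots> = Z U L"
    using Z_eq_sum_Zc[of U L v] admissible_finite[OF adm] admissible_finite_list[OF adm] v Z_forbid
    by (simp add: Zc_def)
  finally show "kappa * real (card ?N) * Zc U L v j \<le> Z U L" .
qed

lemma marginal_le_inverse_beta:
  assumes "admissible U L" "v \<in> U"
  shows "marginal U L v j \<le> 1 / \<beta>"
  using beta_Zc_le[OF assms, of j] Z_pos[OF assms(1)] beta_gt_1
  by (simp add: marginal_def field_simps)

lemma marginal_le_kappa:
  assumes "admissible U L" "v \<in> U" "card (nbs U v) \<noteq> 0"
  shows "marginal U L v j \<le> 1 / (kappa * real (card (nbs U v)))"
  using kappa_Zc_le[OF assms(1,2), of j] Z_pos[OF assms(1)] kappa_pos assms(3)
  by (simp add: marginal_def field_simps)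

lemma marginal_less_1:
  assumes "admissible U L" "v \<in> U"
  shows "marginal U L v j < 1"
  using marginal_le_inverse_beta[OF assms, of j] beta_gt_1
  by (smt (verit) divide_less_eq_1_pos)

text \<open>Turns the removal of a single color at \<open>v\<close> into a factor of the count.
  Admissibility is asked of the full list only; the shortened one may just miss the required
  size.\<close>

lemma Z_avoid:
  assumes "admissible U L" "v \<in> U"
  shows "Z U (L(v := L v - {j})) = Z U L * (1 - marginal U L v j)"
proof -
  note fin = admissible_finite[OF assms(1)] admissible_finite_list[OF assms(1)]
  have eq: "Zc U (L(v := L v - {j})) v a = Zc U L v a" if "a \<in> L v - {j}" for a
    using that loopless unfolding Zc_def
    by (auto intro!: Z_cong simp: forbid_def)
  have "Z U (L(v := L v - {j})) = (\<Sum>a\<in>L v - {j}. Zc U L v a)"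
    using Z_eq_sum_Zc[of U "L(v := L v - {j})" v] fin assms(2) eq by simp
  also have "\<dots> = Z U L - Zc U L v j"
    using Z_eq_sum_Zc[OF fin assms(2)] fin(2)[OF assms(2)]
    by (auto simp: sum_diff1 Zc_def[of U L v j])
  finally show ?thesis using Z_pos[OF assms(1)] by (simp add: marginal_def right_diff_distrib)
qed

end

section \<open>Decay of correlations\<close>

text \<open>As a function of \<open>ln x\<close>, \<open>ln (1 - x)\<close> is decreasing with slope
  \<open>- x / (1 - x)\<close>, whose size is at most \<open>b / (1 - b)\<close>. The proof avoids
  derivatives by applying \<open>ln z \<le> z - 1\<close> twice.\<close>

lemma ln_one_minus_diff_le:
  fixes x y b :: real
  assumes "0 < x" "0 < y" "x \<le> b" "y \<le> b" "b < 1"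
  shows "ln (1 - x) - ln (1 - y) \<le> b / (1 - b) * max 0 (ln y - ln x)"
proof (cases "x < y")
  case False
  hence "ln (1 - x) \<le> ln (1 - y)" using assms by simp
  moreover have "0 \<le> b / (1 - b) * max 0 (ln y - ln x)"
    using assms by (intro mult_nonneg_nonneg) auto
  ultimately show ?thesis by linarith
next
  case True
  have "ln (1 - x) - ln (1 - y) = ln ((1 - x) / (1 - y))" using assms by (simp add: ln_div)
  also have "\<dots> \<le> (1 - x) / (1 - y) - 1" using assms by (intro ln_le_minus_one) auto
  also have "\<dots> = y / (1 - y) * (1 - x / y)" using assms by (simp add: field_simps)
  also have "\<dots> \<le> b / (1 - b) * (ln y - ln x)"
  proof (rule mult_mono)
    show "y / (1 - y) \<le> b / (1 - b)" using assms by (intro frac_le) auto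
    have "ln (x / y) \<le> x / y - 1" using assms by (intro ln_le_minus_one) auto
    thus "1 - x / y \<le> ln y - ln x" using assms by (simp add: ln_div)
    show "0 \<le> b / (1 - b)" using assms by simp
    show "0 \<le> 1 - x / y" using assms True by simp
  qed
  also have "\<dots> \<le> b / (1 - b) * max 0 (ln y - ln x)"
    using assms by (intro mult_left_mono) auto
  finally show ?thesis .
qed

text \<open>Both families sum to 1, so their log-ratio takes a value \<ge> 0 and a value \<le> 0:
  its maximum \<open>M\<close> and minimum \<open>m\<close> satisfy
  \<open>m \<le> 0 \<le> M\<close>. The error at \<open>j\<close> is charged to \<open>- m\<close>,
  the one at \<open>k\<close> to \<open>M\<close>, and together they cost one oscillation
  \<open>M - m\<close>, not two.\<close>

lemma ln_avoid_diff_le: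
  fixes p p' :: "'c \<Rightarrow> real"
  assumes "finite A" "sum p A = 1" "sum p' A = 1"
    and pos: "\<And>a. a \<in> A \<Longrightarrow> 0 < p a" "\<And>a. a \<in> A \<Longrightarrow> 0 < p' a"
    and le: "\<And>a. p a \<le> b" "\<And>a. p' a \<le> b" "b < 1" "0 \<le> b"
    and out: "\<And>a. a \<notin> A \<Longrightarrow> p a = 0" "\<And>a. a \<notin> A \<Longrightarrow> p' a = 0"
    and R: "\<And>a c. a \<in> A \<Longrightarrow> c \<in> A \<Longrightarrow> ln (p a / p' a) - ln (p c / p' c) \<le> R"
  shows "(ln (1 - p j) - ln (1 - p k)) - (ln (1 - p' j) - ln (1 - p' k)) \<le> b / (1 - b) * R"
proof -
  define e where "e a = ln (p a / p' a)" for a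
  have ne: "A \<noteq> {}" using assms(2) by auto
  have g: "b / (1 - b) \<ge> 0" using le by simp
  obtain a1 where a1: "a1 \<in> A" "p a1 \<ge> p' a1"
    using sum_strict_mono[OF assms(1) ne, of p p'] assms(2,3) by (metis less_irrefl not_le)
  obtain a2 where a2: "a2 \<in> A" "p a2 \<le> p' a2"
    using sum_strict_mono[OF assms(1) ne, of p' p] assms(2,3) by (metis less_irrefl not_le)
  define M where "M = Max (e ` A)"
  define m where "m = Min (e ` A)"
  have "e a1 \<ge> 0" "e a2 \<le> 0" using a1 a2 pos by (auto simp: e_def)
  moreover have eM: "e a \<le> M" and em: "m \<le> e a" if "a \<in> A" for a
    using that assms(1) by (auto simp: M_def m_def)
  ultimately have M0: "M \<ge> 0" and m0: "m \<le> 0" using a1 a2 by force+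
  have "M \<in> e ` A" "m \<in> e ` A" unfolding M_def m_def using assms(1) ne by (auto intro: Max_in Min_in)
  hence MR: "M - m \<le> R" using R by (auto simp: e_def)
  have 1: "ln (1 - p j) - ln (1 - p' j) \<le> b / (1 - b) * (- m)"
  proof (cases "j \<in> A")
    case True
    have "ln (p' j) - ln (p j) = - e j" using pos[OF True] by (simp add: e_def ln_div)
    hence "ln (1 - p j) - ln (1 - p' j) \<le> b / (1 - b) * max 0 (- e j)"
      using ln_one_minus_diff_le[of "p j" "p' j" b] True pos le by simp
    also have "\<dots> \<le> b / (1 - b) * (- m)"
      using em[OF True] m0 g by (intro mult_left_mono) auto
    finally show ?thesis .
  next
    case False
    thus ?thesis using out mult_nonneg_nonpos[OF g m0] by simp
  qed
  have 2: "ln (1 - p' k) - ln (1 - p k) \<le> b / (1 - b) * M"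
  proof (cases "k \<in> A")
    case True
    have "ln (p k) - ln (p' k) = e k" using pos[OF True] by (simp add: e_def ln_div)
    hence "ln (1 - p' k) - ln (1 - p k) \<le> b / (1 - b) * max 0 (e k)"
      using ln_one_minus_diff_le[of "p' k" "p k" b] True pos le by simp
    also have "\<dots> \<le> b / (1 - b) * M"
      using eM[OF True] M0 g by (intro mult_left_mono) auto
    finally show ?thesis .
  next
    case False
    thus ?thesis using out mult_nonneg_nonneg[OF g M0] by simp
  qed
  have "(ln (1 - p j) - ln (1 - p k)) - (ln (1 - p' j) - ln (1 - p' k)) 
      \<le> b / (1 - b) * (- m) + b / (1 - b) * M"
    using 1 2 by linarith
  also have "\<dots> = b / (1 - b) * (M - m)" by (simp add: right_diff_distrib)
  also have "\<dots> \<le> b / (1 - b) * R" using MR g by (rule mult_left_mono)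
  finally show ?thesis .
qed

text \<open>Balls are taken in the whole graph, so they do not change when vertices are deleted from
  a region. The recursion starts with the step away from the center, like the induction that passes
  from \<open>v\<close> to its neighbors.\<close>

primrec graph_ball :: "'v set set \<Rightarrow> nat \<Rightarrow> 'v \<Rightarrow> 'v set" where
  "graph_ball E 0 v = {v}"
| "graph_ball E (Suc n) v = insert v (\<Union>u\<in>{u. {u, v} \<in> E}. graph_ball E n u)"

lemma center_in_graph_ball: "v \<in> graph_ball E n v"
  by (cases n) auto

text \<open>Extends a path at its far end, whereas the definition extends it at the center.\<close>

lemma graph_ball_neighbour:
  "u \<in> graph_ball E n v \<Longrightarrow> {u, w} \<in> E \<Longrightarrow> w \<in> graph_ball E (Suc n) v"
proof (induction n arbitrary: v)
  case 0
  thus ?case using center_in_graph_ball[of w E 0] by (auto simp: insert_commute)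
next
  case (Suc n)
  show ?case
  proof (cases "u = v")
    case True
    thus ?thesis
      using Suc.prems(2) center_in_graph_ball[of w E "Suc n"]
      by (auto simp: insert_commute simp del: graph_ball.simps(2) simp add: graph_ball.simps(2)[of E "Suc n"])
  next
    case False
    then obtain x where "{x, v} \<in> E" "u \<in> graph_ball E n x" using Suc.prems(1) by auto
    thus ?thesis
      using Suc.IH[of x] Suc.prems(2) graph_ball.simps(2)[of E "Suc n" v] by blast
  qed
qed

section \<open>Contraction of the oscillation\<close>

context sparse_lists
begin

text \<open>The bound per unit of degree at distance \<open>n\<close>. Marginals are at most
  \<open>1 / \<beta>\<close>, so \<open>ln (1 - p)\<close> lies between
  \<open>- ln (\<beta> / (\<beta> - 1))\<close> and 0; a difference of two such differences is at
  most twice the width, the value at \<open>n = 0\<close>.\<close>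

definition decay :: "nat \<Rightarrow> real" where
  "decay n = 2 * ln (\<beta> / (\<beta> - 1)) * rho ^ n"

lemma decay_nonneg: "decay n \<ge> 0"
  using beta_gt_1 rho_pos by (simp add: decay_def)

lemma decay_Suc: "decay (Suc n) = rho * decay n"
  by (simp add: decay_def)

lemma decay_tendsto: "decay \<longlonglongrightarrow> 0"
  unfolding decay_def
  using tendsto_mult_right_zero[OF LIMSEQ_realpow_zero[of rho]] rho_pos rho_less_1 by auto

text \<open>The ratio of the numbers of colorings with \<open>v\<close> colored \<open>j\<close> and \<open>k\<close> telescopes over the
  neighbors of \<open>v\<close>: \<open>hybrid\<close> forbids \<open>k\<close> on the neighbors in \<open>S\<close> and \<open>j\<close> on the other ones. Moving
  one neighbor \<open>x\<close> into \<open>S\<close> changes the count by the factor \<open>(1 - p k) / (1 - p j)\<close>, where \<open>p\<close> is the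
  marginal at \<open>x\<close> for one and the same family of lists.\<close>

definition hybrid :: "'v \<Rightarrow> nat \<Rightarrow> nat \<Rightarrow> 'v set \<Rightarrow> ('v \<Rightarrow> nat set) \<Rightarrow> 'v \<Rightarrow> nat set" where
  "hybrid v j k S L u =
     (if {u, v} \<in> E then if u \<in> S then L u - {k} else L u - {j} else L u)"

text \<open>The list of \<open>x\<close> is restored in full. Taking \<open>j\<close> or
  \<open>k\<close> away from it afterwards is then an avoidance event for admissible lists, to which
  \<open>Z_avoid\<close> applies.\<close>

lemma admissible_hybrid:
  assumes "admissible U L" "v \<in> U"
  shows "admissible (U - {v}) ((hybrid v j k S L)(x := L x))"
proof (rule admissible_diff[OF assms(1) _ _ _ assms(2)])
  fix u assume "u \<in> U - {v}"
  thus "finite (((hybrid v j k S L)(x := L x)) u)"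
    using admissible_finite_list[OF assms(1), of u] by (auto simp: hybrid_def)
  show "card (L u) \<le> card (((hybrid v j k S L)(x := L x)) u) + 1"
    using card_Diff_singleton_ge by (auto simp: hybrid_def)
qed (simp add: hybrid_def)

lemma Z_hybrid:
  assumes "admissible U L" "v \<in> U" "x \<in> nbs U v"
  shows "x \<notin> S \<Longrightarrow> Z (U - {v}) (hybrid v j k S L) =
      Z (U - {v}) ((hybrid v j k S L)(x := L x)) *
      (1 - marginal (U - {v}) ((hybrid v j k S L)(x := L x)) x j)"
    and "Z (U - {v}) (hybrid v j k (insert x S) L) =
      Z (U - {v}) ((hybrid v j k S L)(x := L x)) *
      (1 - marginal (U - {v}) ((hybrid v j k S L)(x := L x)) x k)"
proof -
  have x: "x \<in> U - {v}" "{x, v} \<in> E"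
    using assms(3) loopless by (auto simp: nbs_def insert_commute)
  let ?B = "(hybrid v j k S L)(x := L x)"
  have Z: "Z (U - {v}) (?B(x := ?B x - {a})) = Z (U - {v}) ?B * (1 - marginal (U - {v}) ?B x a)" for a
    by (rule Z_avoid[OF admissible_hybrid[OF assms(1,2)] x(1)])
  have "?B(x := ?B x - {j}) = hybrid v j k S L" if "x \<notin> S"
    using that x by (auto simp: hybrid_def fun_eq_iff)
  thus "x \<notin> S \<Longrightarrow> Z (U - {v}) (hybrid v j k S L) =
      Z (U - {v}) ?B * (1 - marginal (U - {v}) ?B x j)"
    using Z[of j] by simp
  have "?B(x := ?B x - {k}) = hybrid v j k (insert x S) L"
    using x by (auto simp: hybrid_def fun_eq_iff)
  thus "Z (U - {v}) (hybrid v j k (insert x S) L) =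
      Z (U - {v}) ?B * (1 - marginal (U - {v}) ?B x k)"
    using Z[of k] by simp
qed

lemma ln_one_minus_marginal_bounds:
  assumes "admissible U L" "v \<in> U"
  shows "ln (1 - marginal U L v j) \<le> 0" "- ln (\<beta> / (\<beta> - 1)) \<le> ln (1 - marginal U L v j)"
proof -
  have m: "0 \<le> marginal U L v j" "marginal U L v j \<le> 1 / \<beta>" "marginal U L v j < 1"
    using marginal_nonneg marginal_le_inverse_beta[OF assms] marginal_less_1[OF assms] by auto
  thus "ln (1 - marginal U L v j) \<le> 0" by simp
  have "- ln (\<beta> / (\<beta> - 1)) = ln (1 - 1 / \<beta>)"
    using beta_gt_1 by (simp add: ln_div[symmetric] diff_divide_distrib flip: ln_inverse)
  also have "\<dots> \<le> ln (1 - marginal U L v j)" using m beta_gt_1 by simp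
  finally show "- ln (\<beta> / (\<beta> - 1)) \<le> ln (1 - marginal U L v j)" .
qed

text \<open>Telescoping produces one term per neighbor, which explains the degree factor. By
  induction the oscillation at a neighbor \<open>x\<close> carries the degree of \<open>x\<close>;
  the marginal bound \<open>1 / (kappa * d)\<close> cancels it, so the contraction rate does not
  depend on the degrees.\<close>

lemma marginal_ratio_decay:
  assumes "admissible U L" "admissible U L'" "v \<in> U"
    and "\<And>u. u \<in> graph_ball E n v \<inter> U \<Longrightarrow> L u = L' u"
    and "j \<in> L v" "k \<in> L v"
  shows "ln (marginal U L v j / marginal U L' v j) - ln (marginal U L v k / marginal U L' v k)
    \<le> real (card (nbs U v)) * decay n"
  using assms
proof (induction n arbitrary: U L L' v j k)
  \<comment> \<open>The telescoping part, common to base case and induction step: \<open>d\<close>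
    bounds the contribution of a single neighbor.\<close>
  have step: "ln (marginal U L v j / marginal U L' v j) - ln (marginal U L v k / marginal U L' v k)
      \<le> real (card (nbs U v)) * d"
    if adm: "admissible U L" "admissible U L'" and v: "v \<in> U" "j \<in> L v" "k \<in> L v" "L v = L' v"
      and d: "\<And>x S p p'. x \<in> nbs U v \<Longrightarrow>
          p = marginal (U - {v}) ((hybrid v j k S L)(x := L x)) x \<Longrightarrow>
          p' = marginal (U - {v}) ((hybrid v j k S L')(x := L' x)) x \<Longrightarrow>
          (ln (1 - p j) - ln (1 - p k)) - (ln (1 - p' j) - ln (1 - p' k)) \<le> d"
    for U L L' v j k d
  proof -
    let ?W = "U - {v}"
    let ?F = "\<lambda>L S. Z ?W (hybrid v j k S L)"
    have tele: "(ln (?F L {}) - ln (?F L S)) - (ln (?F L' {}) - ln (?F L' S)) \<le> real (card S) * d"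
      if "finite S" "S \<subseteq> nbs U v" for S
      using that
    proof (induction S)
      case (insert x S)
      hence x: "x \<in> nbs U v" "x \<notin> S" by auto
      have xW: "x \<in> ?W" using x(1) loopless by (auto simp: nbs_def)
      have ln_F: "ln (?F M S) - ln (?F M (insert x S)) =
          ln (1 - marginal ?W ((hybrid v j k S M)(x := M x)) x j) -
          ln (1 - marginal ?W ((hybrid v j k S M)(x := M x)) x k)"
        if M: "admissible U M" for M
      proof -
        let ?B = "(hybrid v j k S M)(x := M x)"
        have B: "admissible ?W ?B" by (rule admissible_hybrid[OF M v(1)])
        show ?thesis
          using Z_pos[OF B] marginal_less_1[OF B xW, of j] marginal_less_1[OF B xW, of k]
          by (simp only: Z_hybrid(1)[OF M v(1) x] Z_hybrid(2)[OF M v(1) x(1)])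
             (simp add: ln_mult_pos)
      qed
      show ?case
        using insert.IH insert.prems insert.hyps ln_F[OF adm(1)] ln_F[OF adm(2)]
          d[OF x(1) refl refl, of S]
        by (simp add: distrib_right)
    qed simp
    \<comment> \<open>The two ends of the telescope. The normalizations \<open>Z U L\<close> and
      \<open>Z U L'\<close> cancel between \<open>j\<close> and \<open>k\<close>.\<close>
    have F: "Zc U M v j = ?F M {}" "Zc U M v k = ?F M (nbs U v)" if "j \<in> M v" "k \<in> M v" for M
      using that unfolding Zc_def
      by (auto intro!: Z_cong simp: forbid_def hybrid_def nbs_def insert_commute)
    have ln_marginal: "ln (marginal U M v a / marginal U M' v a) =
        ln (Zc U M v a) - ln (Z U M) - (ln (Zc U M' v a) - ln (Z U M'))"
      if "admissible U M" "admissible U M'" "a \<in> M v" "a \<in> M' v" for M M' a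
      using that Zc_pos[OF that(1) v(1) that(3)] Zc_pos[OF that(2) v(1) that(4)]
        Z_pos[OF that(1)] Z_pos[OF that(2)]
      by (simp add: marginal_def ln_div ln_mult_pos)
    have v': "j \<in> L' v" "k \<in> L' v" using v by auto
    show ?thesis
      using tele[of "nbs U v"] finite_nbs[OF admissible_finite[OF adm(1)], of v]
        ln_marginal[OF adm v(2) v'(1)] ln_marginal[OF adm v(3) v'(2)]
        F[of L] F[of L'] v(2,3) v' by simp
  qed
  {
    case (0 U L L' v j k)
    show ?case
    proof (rule step[OF 0(1-3,5,6)])
      show "L v = L' v" using 0 by simp
      fix x S p p'
      assume x: "x \<in> nbs U v"
        and p: "p = marginal (U - {v}) ((hybrid v j k S L)(x := L x)) x"
        and p': "p' = marginal (U - {v}) ((hybrid v j k S L')(x := L' x)) x"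
      have xW: "x \<in> U - {v}" using x loopless by (auto simp: nbs_def)
      have b: "ln (1 - p a) \<le> 0 \<and> - ln (\<beta> / (\<beta> - 1)) \<le> ln (1 - p a)" for a
        using ln_one_minus_marginal_bounds[OF admissible_hybrid[OF 0(1,3)] xW] p by simp
      have b': "ln (1 - p' a) \<le> 0 \<and> - ln (\<beta> / (\<beta> - 1)) \<le> ln (1 - p' a)" for a
        using ln_one_minus_marginal_bounds[OF admissible_hybrid[OF 0(2,3)] xW] p' by simp
      have "decay 0 = 2 * ln (\<beta> / (\<beta> - 1))" by (simp add: decay_def)
      thus "(ln (1 - p j) - ln (1 - p k)) - (ln (1 - p' j) - ln (1 - p' k)) \<le> decay 0"
        using b[of j] b[of k] b'[of j] b'[of k] by linarith
    qed
  next
    case (Suc n U L L' v j k)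
    show ?case
    proof (rule step[OF Suc.prems(1-3,5,6)])
      show "L v = L' v" using Suc.prems center_in_graph_ball[of v E "Suc n"] by blast
      fix x S p p'
      assume x: "x \<in> nbs U v"
        and p: "p = marginal (U - {v}) ((hybrid v j k S L)(x := L x)) x"
        and p': "p' = marginal (U - {v}) ((hybrid v j k S L')(x := L' x)) x"
      let ?W = "U - {v}"
      let ?B = "(hybrid v j k S L)(x := L x)"
      let ?B' = "(hybrid v j k S L')(x := L' x)"
      let ?d = "real (card (nbs ?W x))"
      have xW: "x \<in> ?W" using x loopless by (auto simp: nbs_def)
      have adm: "admissible ?W ?B" "admissible ?W ?B'"
        using admissible_hybrid Suc.prems by auto
      have sub: "graph_ball E n x \<subseteq> graph_ball E (Suc n) v"
        using x by (auto simp: nbs_def insert_commute)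
      have BB: "?B u = ?B' u" if "u \<in> graph_ball E n x \<inter> ?W" for u
        using Suc.prems(4)[of u] that sub by (auto simp: hybrid_def)
      have "L x = L' x" using BB[of x] xW center_in_graph_ball[of x E n] by auto
      hence BxB: "?B' x = ?B x" by simp
      \<comment> \<open>For \<open>?d = 0\<close> the quotient \<open>1 / (kappa * ?d)\<close> is 0
        and is no valid bound. There \<open>1 / \<beta>\<close> suffices, since the factor
        \<open>?d\<close> annihilates the term.\<close>
      define b where "b = (if ?d = 0 then 1 / \<beta> else min (1 / \<beta>) (1 / (kappa * ?d)))"
      have b: "0 < b" "b \<le> 1 / \<beta>" using beta_gt_1 kappa_pos by (auto simp: b_def)
      hence b1: "b < 1" using beta_gt_1 by (smt (verit) divide_less_eq_1_pos)
      have "p a \<le> b" "p' a \<le> b" for a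
        using marginal_le_inverse_beta[OF adm(1) xW, of a] marginal_le_inverse_beta[OF adm(2) xW, of a]
          marginal_le_kappa[OF adm(1) xW, of a] marginal_le_kappa[OF adm(2) xW, of a]
        by (auto simp: p p' b_def)
      moreover define A where "A = ?B x"
      have A': "A = ?B' x" using BxB by (simp only: A_def)
      have "finite A" unfolding A_def by (rule admissible_finite_list[OF adm(1) xW])
      moreover have "sum p A = 1" unfolding A_def p by (rule sum_marginal[OF adm(1) xW])
      moreover have "sum p' A = 1" unfolding A' p' by (rule sum_marginal[OF adm(2) xW])
      moreover have "0 < p a" if "a \<in> A" for a
        using marginal_pos[OF adm(1) xW that[unfolded A_def]] by (simp only: p)
      moreover have "0 < p' a" if "a \<in> A" for a
        using marginal_pos[OF adm(2) xW that[unfolded A']] by (simp only: p')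
      moreover have "p a = 0" if "a \<notin> A" for a
        unfolding p by (rule marginal_notin) (rule that[unfolded A_def])
      moreover have "p' a = 0" if "a \<notin> A" for a
        unfolding p' by (rule marginal_notin) (rule that[unfolded A'])
      moreover have "ln (p a / p' a) - ln (p c / p' c) \<le> ?d * decay n" if "a \<in> A" "c \<in> A" for a c
        unfolding p p'
        by (rule Suc.IH[OF adm xW BB that[unfolded A_def]])
      ultimately have "(ln (1 - p j) - ln (1 - p k)) - (ln (1 - p' j) - ln (1 - p' k))
          \<le> b / (1 - b) * (?d * decay n)"
        using b(1) b1 by (intro ln_avoid_diff_le[where A = A]) auto
      also have "\<dots> = (b / (1 - b) * ?d) * decay n" by simp
      also have "\<dots> \<le> rho * decay n"
      proof (rule mult_right_mono[OF _ decay_nonneg])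
        show "b / (1 - b) * ?d \<le> rho"
        proof (cases "?d = 0")
          case True
          thus ?thesis using rho_pos by simp
        next
          case False
          hence "b \<le> 1 / (kappa * ?d)" by (simp add: b_def)
          \<comment> \<open>The degree-dependent bound goes into the numerator and
            \<open>1 / \<beta>\<close> into the denominator; multiplying by \<open>?d\<close> leaves
            exactly \<open>rho\<close>.\<close>
          hence "b / (1 - b) \<le> (1 / (kappa * ?d)) / (1 - 1 / \<beta>)"
            using b beta_gt_1 kappa_pos by (intro frac_le) auto
          hence "b / (1 - b) * ?d \<le> (1 / (kappa * ?d)) / (1 - 1 / \<beta>) * ?d"
            by (intro mult_right_mono) auto
          also have "\<dots> = rho" using False by (simp add: rho_def)
          finally show ?thesis .
        qed
      qed
      finally show "(ln (1 - p j) - ln (1 - p k)) - (ln (1 - p' j) - ln (1 - p' k)) \<le> decay (Suc n)"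
        by (simp add: decay_Suc)
    qed
  }
qed

text \<open>Both marginals sum to 1, so some color \<open>k\<close> has ratio at most 1. Comparing
  \<open>j\<close> with this \<open>k\<close> turns the bound on the oscillation into one on the
  ratio at \<open>j\<close> itself.\<close>

lemma marginal_le_of_agree:
  assumes "admissible U L" "admissible U L'" "v \<in> U"
    and "\<And>u. u \<in> graph_ball E n v \<inter> U \<Longrightarrow> L u = L' u"
    and "card (nbs U v) \<le> D"
  shows "marginal U L v j - marginal U L' v j \<le> exp (real D * decay n) - 1"
proof -
  have Lv: "L v = L' v" using assms(3,4) center_in_graph_ball[of v E n] by auto
  have r0: "exp (real D * decay n) - 1 \<ge> 0" using decay_nonneg by simp
  show ?thesis
  proof (cases "j \<in> L v")
    case False
    thus ?thesis using Lv r0 by (simp add: marginal_notin)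
  next
    case True
    have ne: "L v \<noteq> {}" "finite (L v)"
      using admissible_nonempty admissible_finite_list assms by auto
    have "\<exists>k\<in>L v. marginal U L v k \<le> marginal U L' v k"
      using sum_strict_mono[OF ne(2,1), of "marginal U L' v" "marginal U L v"]
        sum_marginal[OF assms(1,3)] sum_marginal[OF assms(2,3)] Lv by (metis less_irrefl not_le)
    then obtain k where k: "k \<in> L v" "marginal U L v k \<le> marginal U L' v k" by auto
    note pos = marginal_pos[OF assms(1,3)] marginal_pos[OF assms(2,3), folded Lv]
    have "ln (marginal U L v k / marginal U L' v k) \<le> 0"
      using k pos[OF k(1)] by simp
    moreover have "ln (marginal U L v j / marginal U L' v j) - ln (marginal U L v k / marginal U L' v k)
        \<le> real (card (nbs U v)) * decay n"
      by (rule marginal_ratio_decay[OF assms(1-3) _ True k(1)]) (rule assms(4))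
    ultimately have "ln (marginal U L v j / marginal U L' v j) \<le> real (card (nbs U v)) * decay n"
      by linarith
    also have "\<dots> \<le> real D * decay n"
      using assms(5) decay_nonneg by (intro mult_right_mono) auto
    finally have "marginal U L v j / marginal U L' v j \<le> exp (real D * decay n)"
      using pos[OF True] by (metis divide_pos_pos exp_le_cancel_iff exp_ln)
    hence "marginal U L v j - marginal U L' v j \<le> (exp (real D * decay n) - 1) * marginal U L' v j"
      using pos[OF True] by (simp add: field_simps)
    also have "\<dots> \<le> (exp (real D * decay n) - 1) * 1"
      using r0 marginal_less_1[OF assms(2,3), of j] by (intro mult_left_mono) auto
    finally show ?thesis by simp
  qed
qed

lemma marginal_decay:
  assumes "admissible U L" "admissible U L'" "v \<in> U"
    and "\<And>u. u \<in> graph_ball E n v \<inter> U \<Longrightarrow> L u = L' u"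
    and "card (nbs U v) \<le> D"
  shows "\<bar>marginal U L v j - marginal U L' v j\<bar> \<le> exp (real D * decay n) - 1"
proof -
  have "marginal U L v j - marginal U L' v j \<le> exp (real D * decay n) - 1"
    by (rule marginal_le_of_agree[OF assms(1-3) _ assms(5)]) (rule assms(4))
  moreover have "marginal U L' v j - marginal U L v j \<le> exp (real D * decay n) - 1"
    by (rule marginal_le_of_agree[OF assms(2,1,3) _ assms(5)]) (rule assms(4)[symmetric])
  ultimately show ?thesis by (simp add: abs_le_iff)
qed

section \<open>From single vertices to finite patterns\<close>

definition pattern_prob :: "'v set \<Rightarrow> ('v \<Rightarrow> nat set) \<Rightarrow> 'v set \<Rightarrow> ('v \<Rightarrow> nat) \<Rightarrow> real" where
  "pattern_prob U L S \<xi> = real (card {c \<in> list_colorings E L U. \<forall>s\<in>S. c s = \<xi> s}) / Z U L"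

lemma pattern_prob_chain:
  assumes "admissible U L" "v \<in> U" "v \<notin> S"
  shows "pattern_prob U L (insert v S) \<xi> =
    marginal U L v (\<xi> v) * pattern_prob (U - {v}) (forbid E v (\<xi> v) L) S \<xi>"
proof (cases "\<xi> v \<in> L v")
  case True
  have "card {c \<in> list_colorings E L U. \<forall>s\<in>insert v S. c s = \<xi> s} =
      card {c \<in> list_colorings E (forbid E v (\<xi> v) L) (U - {v}). \<forall>s\<in>S. c s = \<xi> s}"
    using card_list_colorings_fix[of v "insert v S" U E \<xi> L] assms(2,3) True loopless by simp
  thus ?thesis
    using Z_pos[OF admissible_forbid[OF assms(1,2)], of "\<xi> v"] True
    by (simp add: pattern_prob_def marginal_def Zc_def)
next
  case False
  hence "{c \<in> list_colorings E L U. \<forall>s\<in>insert v S. c s = \<xi> s} = {}"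
    using assms(2) by (fastforce simp: list_colorings_def PiE_iff)
  thus ?thesis
    by (simp only: pattern_prob_def marginal_notin[of "\<xi> v" L v, OF False]) simp
qed

lemma pattern_prob_bounds:
  assumes "admissible U L"
  shows "0 \<le> pattern_prob U L S \<xi>" "pattern_prob U L S \<xi> \<le> 1"
proof -
  have "card {c \<in> list_colorings E L U. \<forall>s\<in>S. c s = \<xi> s} \<le> card (list_colorings E L U)"
    using finite_list_colorings[of U L E] assms
    by (intro card_mono) (auto simp: admissible_def)
  thus "pattern_prob U L S \<xi> \<le> 1"
    using Z_pos[OF assms] by (simp add: pattern_prob_def Z_def)
qed (simp add: pattern_prob_def Z_nonneg)

text \<open>The vertices of \<open>S\<close> are revealed one by one with the chain rule, each
  costing one single-vertex error. Forbidding the same color in both families preserves their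
  agreement near \<open>S\<close>, and deleting vertices only lowers degrees.\<close>

lemma pattern_prob_decay:
  assumes "finite S" "admissible U L" "admissible U L'" "S \<subseteq> U"
    and "\<And>s u. s \<in> S \<Longrightarrow> u \<in> graph_ball E n s \<inter> U \<Longrightarrow> L u = L' u"
    and "\<And>u. u \<in> U \<Longrightarrow> card (nbs U u) \<le> D"
  shows "\<bar>pattern_prob U L S \<xi> - pattern_prob U L' S \<xi>\<bar> \<le> real (card S) * (exp (real D * decay n) - 1)"
  using assms
proof (induction S arbitrary: U L L')
  case empty
  thus ?case using Z_pos[OF empty.prems(1)] Z_pos[OF empty.prems(2)]
    by (simp add: pattern_prob_def Z_def)
next
  case (insert v S)
  have v: "v \<in> U" using insert.prems(3) by simp
  let ?U = "U - {v}"
  let ?L = "forbid E v (\<xi> v) L"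
  let ?L' = "forbid E v (\<xi> v) L'"
  let ?r = "exp (real D * decay n) - 1"
  have 1: "\<bar>marginal U L v (\<xi> v) - marginal U L' v (\<xi> v)\<bar> \<le> ?r"
    using insert.prems v by (intro marginal_decay) auto
  have adm: "admissible ?U ?L" "admissible ?U ?L'"
    using admissible_forbid insert.prems(1,2) v by auto
  have 2: "\<bar>pattern_prob ?U ?L S \<xi> - pattern_prob ?U ?L' S \<xi>\<bar> \<le> real (card S) * ?r"
  proof (rule insert.IH[OF adm])
    show "S \<subseteq> ?U" using insert by auto
    show "?L u = ?L' u" if "s \<in> S" "u \<in> graph_ball E n s \<inter> ?U" for s u
      using insert.prems(4)[of s u] that by (auto simp: forbid_def)
    show "card (nbs ?U u) \<le> D" if "u \<in> ?U" for u
      using insert.prems(5)[of u] that card_Diff1_le[of "nbs U u" v] by (simp add: nbs_diff)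
  qed
  let ?p = "marginal U L v (\<xi> v)"
  let ?p' = "marginal U L' v (\<xi> v)"
  let ?q = "pattern_prob ?U ?L S \<xi>"
  let ?q' = "pattern_prob ?U ?L' S \<xi>"
  have "\<bar>?p * ?q - ?p' * ?q'\<bar> = \<bar>(?p - ?p') * ?q + ?p' * (?q - ?q')\<bar>" by (simp add: algebra_simps)
  also have "\<dots> \<le> \<bar>(?p - ?p') * ?q\<bar> + \<bar>?p' * (?q - ?q')\<bar>" by (rule abs_triangle_ineq)
  also have "\<dots> \<le> ?r * 1 + 1 * (real (card S) * ?r)"
    unfolding abs_mult
    using 1 2 pattern_prob_bounds[OF adm(1)] marginal_nonneg marginal_less_1[OF insert.prems(2) v, of "\<xi> v"]
      decay_nonneg
    by (intro add_mono mult_mono) auto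
  finally show ?case
    using insert.hyps pattern_prob_chain[OF insert.prems(1) v insert.hyps(2)]
      pattern_prob_chain[OF insert.prems(2) v insert.hyps(2)]
    by (simp add: algebra_simps)
qed

end

section \<open>The finite-volume specification\<close>

text \<open>Greedy coloring along a well-order of the vertices, which works for uncountable
  \<open>V\<close> as well: at most \<open>card (neighbours E v)\<close> colors are taken when
  \<open>v\<close> is reached.\<close>

lemma list_colorings_nonempty:
  assumes "\<And>v. {v} \<notin> E"
    and "\<And>v. v \<in> V \<Longrightarrow> finite (neighbours E v) \<and> finite (L v) \<and> card (neighbours E v) < card (L v)"
  shows "list_colorings E L V \<noteq> {}"
proof -
  obtain r :: "'a rel" where r: "well_order_on UNIV r" using well_order_on by blast
  define R where "R = r - Id"
  have wf: "wf R" using r by (simp add: R_def well_order_on_def)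
  have total: "(u, v) \<in> R \<or> (v, u) \<in> R" if "u \<noteq> v" for u v
    using r that by (auto simp: R_def well_order_on_def linear_order_on_def total_on_def)
  define c where "c = wfrec R (\<lambda>f v. SOME k. k \<in> L v - f ` {u \<in> neighbours E v. (u, v) \<in> R})"
  have c: "c v \<in> L v - c ` {u \<in> neighbours E v. (u, v) \<in> R}" if v: "v \<in> V" for v
  proof -
    let ?N = "{u \<in> neighbours E v. (u, v) \<in> R}"
    have "card (c ` ?N) \<le> card ?N" using assms(2)[OF v] by (intro card_image_le) auto
    also have "\<dots> \<le> card (neighbours E v)" using assms(2)[OF v] by (intro card_mono) auto
    also have "\<dots> < card (L v)" using assms(2)[OF v] by simp
    finally have less: "card (c ` ?N) < card (L v)" .
    have "finite (c ` ?N)" using assms(2)[OF v] by simp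
    hence "\<not> L v \<subseteq> c ` ?N" using card_mono[of "c ` ?N" "L v"] less by linarith
    hence ex: "\<exists>k. k \<in> L v - c ` ?N" by auto
    have "c v = (SOME k. k \<in> L v - cut c R v ` ?N)"
      unfolding c_def by (subst wfrec[OF wf]) simp
    \<comment> \<open>The choice at \<open>v\<close> consults only predecessors, where
      \<open>cut\<close> changes nothing.\<close>
    moreover have "cut c R v ` ?N = c ` ?N" by (intro image_cong) (auto simp: cut_apply)
    ultimately have "c v = (SOME k. k \<in> L v - c ` ?N)" by simp
    thus ?thesis using someI_ex[OF ex] by metis
  qed
  have "restrict c V \<in> list_colorings E L V"
    unfolding list_colorings_def
  proof (intro CollectI conjI ballI impI)
    show "restrict c V \<in> (\<Pi>\<^sub>E u\<in>V. L u)" using c by auto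
    fix u v assume uv: "u \<in> V" "v \<in> V" "{u, v} \<in> E"
    hence "u \<noteq> v" using assms(1) by auto
    hence "(u, v) \<in> R \<or> (v, u) \<in> R" by (rule total)
    hence "c u \<noteq> c v"
    proof
      assume "(u, v) \<in> R"
      hence "u \<in> {u \<in> neighbours E v. (u, v) \<in> R}" using uv by (simp add: neighbours_def)
      hence "c u \<in> c ` {u \<in> neighbours E v. (u, v) \<in> R}" by (rule imageI)
      moreover have "c v \<notin> c ` {u \<in> neighbours E v. (u, v) \<in> R}"
        using c[OF uv(2)] by (rule DiffE)
      ultimately show ?thesis by metis
    next
      assume "(v, u) \<in> R"
      hence "v \<in> {v \<in> neighbours E u. (v, u) \<in> R}" using uv by (simp add: neighbours_def insert_commute)
      hence "c v \<in> c ` {v \<in> neighbours E u. (v, u) \<in> R}" by (rule imageI)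
      moreover have "c u \<notin> c ` {v \<in> neighbours E u. (v, u) \<in> R}"
        using c[OF uv(1)] by (rule DiffE)
      ultimately show ?thesis by metis
    qed
    thus "restrict c V u \<noteq> restrict c V v" using uv by simp
  qed
  thus ?thesis by blast
qed

section \<open>Recoloring a finite region with a fixed exterior\<close>

locale sparse_graph = sparse_lists E \<alpha> \<beta> for E :: "'v set set" and \<alpha> \<beta> +
  fixes V :: "'v set" and L :: "'v \<Rightarrow> nat set" and D :: nat
  assumes edge_in_V: "{u, v} \<in> E \<Longrightarrow> u \<in> V"
    and finite_neighbours: "v \<in> V \<Longrightarrow> finite (neighbours E v)"
    and degree_le: "v \<in> V \<Longrightarrow> vertex_degree E v \<le> D"
    and finite_list: "v \<in> V \<Longrightarrow> finite (L v)"
    and card_list: "v \<in> V \<Longrightarrow> \<alpha> * real (vertex_degree E v) + \<beta> \<le> real (card (L v))"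
begin

abbreviation \<Omega> :: "('v \<Rightarrow> nat) set" where
  "\<Omega> \<equiv> list_colorings E L V"

lemma Omega_nonempty: "\<Omega> \<noteq> {}"
proof (rule list_colorings_nonempty[OF loopless])
  fix v assume v: "v \<in> V"
  have "1 * real (vertex_degree E v) \<le> \<alpha> * real (vertex_degree E v)"
    using alpha_ge_1 by (intro mult_right_mono) auto
  hence "card (neighbours E v) < card (L v)"
    using card_list[OF v] beta_gt_1 by (simp add: vertex_degree_def)
  thus "finite (neighbours E v) \<and> finite (L v) \<and> card (neighbours E v) < card (L v)"
    using v finite_neighbours finite_list by blast
qed

lemma graph_ball_subset: "v \<in> V \<Longrightarrow> graph_ball E n v \<subseteq> V"
proof (induction n arbitrary: v)
  case (Suc n)
  have "graph_ball E n u \<subseteq> V" if "{u, v} \<in> E" for u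
    using Suc.IH edge_in_V[OF that] by simp
  thus ?case using Suc.prems by auto
qed simp

lemma finite_graph_ball: "v \<in> V \<Longrightarrow> finite (graph_ball E n v)"
proof (induction n arbitrary: v)
  case (Suc n)
  have "finite {u. {u, v} \<in> E}" using finite_neighbours[OF Suc.prems] by (simp add: neighbours_def)
  moreover have "finite (graph_ball E n u)" if "u \<in> {u. {u, v} \<in> E}" for u
    using that Suc.IH edge_in_V[of u v] by simp
  ultimately show ?case by simp
qed simp

text \<open>Recolorings are kept as colorings of all of \<open>V\<close>, so that the specifications
  for different regions live on one space and can be averaged against each other. For fixed \<Psi>
  these sets are the classes of an equivalence relation on \<Omega>.\<close>

definition refill :: "'v set \<Rightarrow> ('v \<Rightarrow> nat) \<Rightarrow> ('v \<Rightarrow> nat) set" where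
  "refill \<Psi> \<omega> = {\<omega>' \<in> \<Omega>. \<forall>v\<in>V - \<Psi>. \<omega>' v = \<omega> v}"

definition spec_prob :: "'v set \<Rightarrow> ('v \<Rightarrow> nat) \<Rightarrow> ('v \<Rightarrow> nat) set \<Rightarrow> real" where
  "spec_prob \<Psi> \<omega> A = real (card (refill \<Psi> \<omega> \<inter> A)) / real (card (refill \<Psi> \<omega>))"

text \<open>Absorbs the boundary condition into the lists, which reduces the specification to
  counting list colorings of \<Psi>.\<close>

definition boundary_lists :: "'v set \<Rightarrow> ('v \<Rightarrow> nat) \<Rightarrow> 'v \<Rightarrow> nat set" where
  "boundary_lists \<Psi> \<omega> u = L u - \<omega> ` (neighbours E u - \<Psi>)"

lemma neighbours_subset: "neighbours E u \<subseteq> V"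
  by (auto simp: neighbours_def dest: edge_in_V)

lemma nbs_eq: "nbs \<Psi> u = neighbours E u \<inter> \<Psi>"
  by (auto simp: nbs_def neighbours_def insert_commute)

lemma admissible_boundary_lists:
  assumes "finite \<Psi>" "\<Psi> \<subseteq> V"
  shows "admissible \<Psi> (boundary_lists \<Psi> \<omega>)"
  unfolding admissible_def
proof (intro conjI ballI)
  fix u assume "u \<in> \<Psi>"
  hence u: "u \<in> V" using assms by auto
  note fin = finite_neighbours[OF u] finite_list[OF u]
  show "finite (boundary_lists \<Psi> \<omega> u)" using fin by (simp add: boundary_lists_def)
  let ?N = "neighbours E u"
  have "card (L u) \<le> card (boundary_lists \<Psi> \<omega> u) + card (\<omega> ` (?N - \<Psi>))"
    unfolding boundary_lists_def using diff_card_le_card_Diff[of "\<omega> ` (?N - \<Psi>)" "L u"] fin by simp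
  also have "card (\<omega> ` (?N - \<Psi>)) \<le> card (?N - \<Psi>)" using fin by (intro card_image_le) auto
  finally have "real (card (L u)) \<le> real (card (boundary_lists \<Psi> \<omega> u)) + real (card (?N - \<Psi>))"
    by linarith
  moreover have "real (card ?N) = real (card (nbs \<Psi> u)) + real (card (?N - \<Psi>))"
    using card_Int_Diff[OF fin(1), of \<Psi>] by (simp add: nbs_eq)
  moreover have "1 * real (card (?N - \<Psi>)) \<le> \<alpha> * real (card (?N - \<Psi>))"
    using alpha_ge_1 by (intro mult_right_mono) auto
  ultimately show "\<alpha> * real (card (nbs \<Psi> u)) + \<beta> \<le> real (card (boundary_lists \<Psi> \<omega> u))"
    using card_list[OF u] by (simp add: vertex_degree_def algebra_simps)
qed (use assms in simp)

lemma compatible_colorings_eq: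
  assumes "\<Psi> \<subseteq> V"
  shows "compatible_colorings V E L \<Psi> (restrict \<omega> (V - \<Psi>)) =
    list_colorings E (boundary_lists \<Psi> \<omega>) \<Psi>"
proof -
  have "(\<forall>w\<in>V - \<Psi>. {u, w} \<in> E \<longrightarrow> c u \<noteq> restrict \<omega> (V - \<Psi>) w) \<longleftrightarrow>
      c u \<notin> \<omega> ` (neighbours E u - \<Psi>)" for c u
    using neighbours_subset[of u] by (auto simp: neighbours_def insert_commute)
  thus ?thesis
    unfolding compatible_colorings_def list_colorings_def boundary_lists_def PiE_iff by auto
qed

lemma bij_betw_refill:
  assumes "\<omega> \<in> \<Omega>" "\<Psi> \<subseteq> V"
  shows "bij_betw (\<lambda>\<omega>'. restrict \<omega>' \<Psi>) (refill \<Psi> \<omega>)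
    (list_colorings E (boundary_lists \<Psi> \<omega>) \<Psi>)"
proof (rule bij_betw_byWitness[where f' = "\<lambda>c v. if v \<in> \<Psi> then c v else \<omega> v"])
  have out: "\<omega> v = undefined" if "v \<notin> V" for v
    using assms(1) that by (auto simp: list_colorings_def PiE_iff extensional_def)
  show "\<forall>\<omega>'\<in>refill \<Psi> \<omega>. (\<lambda>v. if v \<in> \<Psi> then restrict \<omega>' \<Psi> v else \<omega> v) = \<omega>'"
  proof (intro ballI ext)
    fix \<omega>' v assume "\<omega>' \<in> refill \<Psi> \<omega>"
    thus "(if v \<in> \<Psi> then restrict \<omega>' \<Psi> v else \<omega> v) = \<omega>' v"
      using out[of v]
      by (cases "v \<in> V") (auto simp: refill_def list_colorings_def PiE_iff extensional_def)
  qed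
  show "\<forall>c\<in>list_colorings E (boundary_lists \<Psi> \<omega>) \<Psi>.
      restrict (\<lambda>v. if v \<in> \<Psi> then c v else \<omega> v) \<Psi> = c"
    by (auto simp: list_colorings_def PiE_iff extensional_def fun_eq_iff)
  show "(\<lambda>\<omega>'. restrict \<omega>' \<Psi>) ` refill \<Psi> \<omega> \<subseteq> list_colorings E (boundary_lists \<Psi> \<omega>) \<Psi>"
  proof (rule image_subsetI)
    fix \<omega>' assume \<omega>': "\<omega>' \<in> refill \<Psi> \<omega>"
    have "\<omega>' u \<notin> \<omega> ` (neighbours E u - \<Psi>)" if "u \<in> \<Psi>" for u
    proof
      assume "\<omega>' u \<in> \<omega> ` (neighbours E u - \<Psi>)"
      then obtain w where w: "w \<in> neighbours E u" "w \<notin> \<Psi>" "\<omega>' u = \<omega> w" by auto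
      hence "w \<in> V" "{u, w} \<in> E" using neighbours_subset by (auto simp: neighbours_def insert_commute)
      moreover have "u \<in> V" using that assms(2) by auto
      moreover have "\<omega>' \<in> \<Omega>" using \<omega>' by (simp add: refill_def)
      ultimately have "\<omega>' u \<noteq> \<omega>' w" by (simp add: list_colorings_def)
      moreover have "\<omega>' w = \<omega> w" using \<omega>' \<open>w \<in> V\<close> w(2) by (simp add: refill_def)
      ultimately show False using w(3) by simp
    qed
    thus "restrict \<omega>' \<Psi> \<in> list_colorings E (boundary_lists \<Psi> \<omega>) \<Psi>"
      using \<omega>' assms(2)
      by (auto simp: refill_def list_colorings_def boundary_lists_def PiE_iff subset_eq)
  qed
  show "(\<lambda>c v. if v \<in> \<Psi> then c v else \<omega> v) ` list_colorings E (boundary_lists \<Psi> \<omega>) \<Psi> \<subseteq> refill \<Psi> \<omega>"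
  proof (rule image_subsetI)
    fix c assume c: "c \<in> list_colorings E (boundary_lists \<Psi> \<omega>) \<Psi>"
    have cross: "c u \<noteq> \<omega> w" if "u \<in> \<Psi>" "w \<notin> \<Psi>" "{u, w} \<in> E" for u w
    proof -
      have "w \<in> neighbours E u - \<Psi>" using that by (simp add: neighbours_def insert_commute)
      thus ?thesis using c that(1) by (auto simp: list_colorings_def boundary_lists_def PiE_iff)
    qed
    show "(\<lambda>v. if v \<in> \<Psi> then c v else \<omega> v) \<in> refill \<Psi> \<omega>"
      unfolding refill_def list_colorings_def[of E L V]
    proof (intro CollectI conjI ballI impI)
      show "(\<lambda>v. if v \<in> \<Psi> then c v else \<omega> v) \<in> (\<Pi>\<^sub>E u\<in>V. L u)"
        using c assms by (auto simp: list_colorings_def boundary_lists_def PiE_iff extensional_def)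
      fix u v assume uv: "u \<in> V" "v \<in> V" "{u, v} \<in> E"
      show "(if u \<in> \<Psi> then c u else \<omega> u) \<noteq> (if v \<in> \<Psi> then c v else \<omega> v)"
        using uv c assms(1) cross[of u v] cross[of v u]
        by (auto simp: list_colorings_def insert_commute)
    qed auto
  qed
qed

lemma spec_prob_restrict:
  assumes "\<omega> \<in> \<Omega>" "\<Psi> \<subseteq> V"
  shows "spec_prob \<Psi> \<omega> {\<omega>' \<in> \<Omega>. P (restrict \<omega>' \<Psi>)} =
    real (card {c \<in> list_colorings E (boundary_lists \<Psi> \<omega>) \<Psi>. P c}) / Z \<Psi> (boundary_lists \<Psi> \<omega>)"
proof -
  note bij = bij_betw_refill[OF assms]
  have img: "(\<lambda>\<omega>'. restrict \<omega>' \<Psi>) ` (refill \<Psi> \<omega> \<inter> {\<omega>' \<in> \<Omega>. P (restrict \<omega>' \<Psi>)}) =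
      {c \<in> list_colorings E (boundary_lists \<Psi> \<omega>) \<Psi>. P c}"
    unfolding bij_betw_imp_surj_on[OF bij, symmetric] by (auto simp: refill_def)
  have "inj_on (\<lambda>\<omega>'. restrict \<omega>' \<Psi>) (refill \<Psi> \<omega> \<inter> {\<omega>' \<in> \<Omega>. P (restrict \<omega>' \<Psi>)})"
    using bij_betw_imp_inj_on[OF bij] by (rule inj_on_subset) auto
  from card_image[OF this] have "card (refill \<Psi> \<omega> \<inter> {\<omega>' \<in> \<Omega>. P (restrict \<omega>' \<Psi>)}) =
      card {c \<in> list_colorings E (boundary_lists \<Psi> \<omega>) \<Psi>. P c}"
    unfolding img by simp
  thus ?thesis using bij_betw_same_card[OF bij] by (simp add: spec_prob_def Z_def)
qed

lemma finite_refill: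
  assumes "\<omega> \<in> \<Omega>" "\<Psi> \<subseteq> V" "finite \<Psi>"
  shows "finite (refill \<Psi> \<omega>)"
proof -
  have "finite (list_colorings E (boundary_lists \<Psi> \<omega>) \<Psi>)"
    using admissible_boundary_lists[OF assms(3,2)]
    by (intro finite_list_colorings assms(3)) (rule admissible_finite_list)
  thus ?thesis using bij_betw_finite[OF bij_betw_refill[OF assms(1,2)]] by simp
qed

lemma refill_self: "\<omega> \<in> \<Omega> \<Longrightarrow> \<omega> \<in> refill \<Psi> \<omega>"
  by (simp add: refill_def)

lemma card_refill_pos:
  assumes "\<omega> \<in> \<Omega>" "\<Psi> \<subseteq> V" "finite \<Psi>"
  shows "card (refill \<Psi> \<omega>) > 0"
  using finite_refill[OF assms] refill_self[OF assms(1), of \<Psi>] by (auto simp: card_gt_0_iff)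

lemma spec_prob_eq_pattern_prob:
  assumes "\<omega> \<in> \<Omega>" "\<Psi> \<subseteq> V" "S \<subseteq> \<Psi>"
  shows "spec_prob \<Psi> \<omega> {\<omega>' \<in> \<Omega>. \<forall>s\<in>S. \<omega>' s = \<xi> s} = pattern_prob \<Psi> (boundary_lists \<Psi> \<omega>) S \<xi>"
proof -
  have "{\<omega>' \<in> \<Omega>. \<forall>s\<in>S. \<omega>' s = \<xi> s} = {\<omega>' \<in> \<Omega>. \<forall>s\<in>S. restrict \<omega>' \<Psi> s = \<xi> s}"
    using assms(3) by auto
  thus ?thesis
    using spec_prob_restrict[OF assms(1,2), of "\<lambda>c. \<forall>s\<in>S. c s = \<xi> s"] by (simp add: pattern_prob_def)
qed

text \<open>Connects the counts with the given specification. Admissibility provides the finite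
  non-empty set without which \<open>pmf_of_set\<close> would carry no information.\<close>

lemma spec_prob_eq_pmf:
  assumes "\<omega> \<in> \<Omega>" "\<Psi> \<subseteq> V" "finite \<Psi>"
  shows "spec_prob \<Psi> \<omega> {\<omega>' \<in> \<Omega>. restrict \<omega>' \<Psi> = \<xi>} =
    pmf (uniform_spec V E L \<Psi> (restrict \<omega> (V - \<Psi>))) \<xi>"
proof -
  let ?C = "list_colorings E (boundary_lists \<Psi> \<omega>) \<Psi>"
  have adm: "admissible \<Psi> (boundary_lists \<Psi> \<omega>)" by (rule admissible_boundary_lists[OF assms(3,2)])
  have fin: "finite ?C" using finite_list_colorings[of \<Psi> _ E] adm by (auto simp: admissible_def)
  have ne: "?C \<noteq> {}" using Z_pos[OF adm] by (auto simp: Z_def)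
  have "real (card {c \<in> ?C. c = \<xi>}) = indicator ?C \<xi>"
  proof (cases "\<xi> \<in> ?C")
    case True
    hence "{c \<in> ?C. c = \<xi>} = {\<xi>}" by auto
    thus ?thesis using True by simp
  next
    case False
    hence "{c \<in> ?C. c = \<xi>} = {}" by auto
    thus ?thesis using False by simp
  qed
  thus ?thesis
    unfolding spec_prob_restrict[OF assms(1,2), of "\<lambda>c. c = \<xi>"] uniform_spec_def
      compatible_colorings_eq[OF assms(2)] pmf_of_set[OF ne fin] by (simp add: Z_def)
qed

text \<open>Spatial Markov property: the exterior coloring enters only through the lists, and these
  read it only at neighbors of \<Psi>.\<close>

lemma spec_prob_cong:
  assumes "\<And>v. v \<in> (\<Union>u\<in>\<Psi>. neighbours E u) - \<Psi> \<Longrightarrow> \<omega> v = \<omega>' v"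
    and "\<omega> \<in> \<Omega>" "\<omega>' \<in> \<Omega>" "\<Psi> \<subseteq> V"
  shows "spec_prob \<Psi> \<omega> {\<tau> \<in> \<Omega>. restrict \<tau> \<Psi> = \<xi>} = spec_prob \<Psi> \<omega>' {\<tau> \<in> \<Omega>. restrict \<tau> \<Psi> = \<xi>}"
proof -
  have "boundary_lists \<Psi> \<omega> u = boundary_lists \<Psi> \<omega>' u" if "u \<in> \<Psi>" for u
    using assms(1) that unfolding boundary_lists_def by (intro arg_cong2[where f = minus] image_cong) auto
  hence "list_colorings E (boundary_lists \<Psi> \<omega>) \<Psi> = list_colorings E (boundary_lists \<Psi> \<omega>') \<Psi>"
    by (rule list_colorings_cong)
  thus ?thesis
    using spec_prob_restrict[OF assms(2,4), of "\<lambda>c. c = \<xi>"]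
      spec_prob_restrict[OF assms(3,4), of "\<lambda>c. c = \<xi>"] by (simp add: Z_def)
qed

section \<open>Local events and the sigma-algebras they generate\<close>

definition determined_on :: "'v set \<Rightarrow> ('v \<Rightarrow> nat) set \<Rightarrow> bool" where
  "determined_on S A \<longleftrightarrow>
     (\<forall>\<omega>\<in>\<Omega>. \<forall>\<omega>'\<in>\<Omega>. (\<forall>s\<in>S. \<omega> s = \<omega>' s) \<longrightarrow> \<omega> \<in> A \<longrightarrow> \<omega>' \<in> A)"

text \<open>The cylinder events over finite subsets of \<open>W\<close>, taken inside \<Omega>
  rather than in the product of the lists.\<close>

definition local_events :: "'v set \<Rightarrow> ('v \<Rightarrow> nat) set set" where
  "local_events W = {A. A \<subseteq> \<Omega> \<and> (\<exists>S. finite S \<and> S \<subseteq> W \<and> determined_on S A)}"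

lemma determined_onD:
  "determined_on S A \<Longrightarrow> \<omega> \<in> \<Omega> \<Longrightarrow> \<omega>' \<in> \<Omega> \<Longrightarrow> (\<And>s. s \<in> S \<Longrightarrow> \<omega> s = \<omega>' s) \<Longrightarrow> \<omega> \<in> A \<longleftrightarrow> \<omega>' \<in> A"
  unfolding determined_on_def by metis

lemma finite_restrictions:
  assumes "finite S" "S \<subseteq> V"
  shows "finite ((\<lambda>\<omega>. restrict \<omega> S) ` \<Omega>)"
proof (rule finite_subset)
  show "(\<lambda>\<omega>. restrict \<omega> S) ` \<Omega> \<subseteq> (\<Pi>\<^sub>E s\<in>S. L s)"
    using assms(2) by (auto simp: list_colorings_def PiE_iff)
  show "finite (\<Pi>\<^sub>E s\<in>S. L s)" using assms finite_list by (intro finite_PiE) auto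
qed

lemma spec_prob_UN:
  assumes "finite X" "\<omega> \<in> \<Omega>" "\<Psi> \<subseteq> V" "finite \<Psi>"
    and "\<And>x y. x \<in> X \<Longrightarrow> y \<in> X \<Longrightarrow> x \<noteq> y \<Longrightarrow> A x \<inter> A y = {}"
  shows "spec_prob \<Psi> \<omega> (\<Union>x\<in>X. A x) = (\<Sum>x\<in>X. spec_prob \<Psi> \<omega> (A x))"
proof -
  have "card (\<Union>x\<in>X. refill \<Psi> \<omega> \<inter> A x) = (\<Sum>x\<in>X. card (refill \<Psi> \<omega> \<inter> A x))"
  proof (rule card_UN_disjoint[OF assms(1)])
    show "\<forall>x\<in>X. finite (refill \<Psi> \<omega> \<inter> A x)" using finite_refill[OF assms(2-4)] by simp
    show "\<forall>x\<in>X. \<forall>y\<in>X. x \<noteq> y \<longrightarrow> (refill \<Psi> \<omega> \<inter> A x) \<inter> (refill \<Psi> \<omega> \<inter> A y) = {}"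
      using assms(5) by blast
  qed
  hence "card (refill \<Psi> \<omega> \<inter> (\<Union>x\<in>X. A x)) = (\<Sum>x\<in>X. card (refill \<Psi> \<omega> \<inter> A x))"
    by (simp only: Int_UN_distrib)
  thus ?thesis by (simp only: spec_prob_def of_nat_sum sum_divide_distrib)
qed

text \<open>The event is a finite disjoint union of cylinders over some \<open>S\<close>. If \<Psi>
  reaches far beyond \<open>S\<close>, any two boundary conditions give the same lists near
  \<open>S\<close>, and decay applies to each cylinder.\<close>

lemma spec_prob_decay:
  assumes A: "A \<in> local_events V" and "\<epsilon> > 0"
  shows "\<exists>\<Psi>. finite \<Psi> \<and> \<Psi> \<subseteq> V \<and> A \<in> local_events \<Psi> \<and>
    (\<forall>\<omega>\<in>\<Omega>. \<forall>\<omega>'\<in>\<Omega>. \<bar>spec_prob \<Psi> \<omega> A - spec_prob \<Psi> \<omega>' A\<bar> \<le> \<epsilon>)"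
proof -
  obtain S where S: "finite S" "S \<subseteq> V" "A \<subseteq> \<Omega>" and det: "determined_on S A"
    using A unfolding local_events_def by blast
  define X where "X = (\<lambda>\<omega>. restrict \<omega> S) ` A"
  have finX: "finite X" unfolding X_def
    using finite_subset[OF image_mono[OF S(3)] finite_restrictions[OF S(1,2)]] .
  define cyl where "cyl \<xi> = {\<omega> \<in> \<Omega>. \<forall>s\<in>S. \<omega> s = \<xi> s}" for \<xi> :: "'v \<Rightarrow> nat"
  have A_eq: "A = (\<Union>\<xi>\<in>X. cyl \<xi>)"
  proof (intro equalityI subsetI)
    fix \<omega> assume "\<omega> \<in> A"
    thus "\<omega> \<in> (\<Union>\<xi>\<in>X. cyl \<xi>)" using S(3) by (auto simp: X_def cyl_def)
  next
    fix \<omega> assume "\<omega> \<in> (\<Union>\<xi>\<in>X. cyl \<xi>)"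
    then obtain \<omega>' where "\<omega>' \<in> A" "\<omega> \<in> \<Omega>" "\<forall>s\<in>S. \<omega>' s = \<omega> s" by (auto simp: X_def cyl_def)
    thus "\<omega> \<in> A" using determined_onD[OF det, of \<omega>' \<omega>] S(3) by auto
  qed
  have disj: "cyl \<xi> \<inter> cyl \<eta> = {}" if "\<xi> \<in> X" "\<eta> \<in> X" "\<xi> \<noteq> \<eta>" for \<xi> \<eta>
  proof -
    have "\<xi> \<in> extensional S" "\<eta> \<in> extensional S" using that by (auto simp: X_def)
    thus ?thesis using that(3) extensionalityI[of \<xi> S \<eta>] by (auto simp: cyl_def)
  qed
  let ?K = "real (card X) * real (card S)"
  have "(\<lambda>n. ?K * (exp (real D * decay n) - 1)) \<longlonglongrightarrow> ?K * (exp (real D * 0) - 1)"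
    by (intro tendsto_intros decay_tendsto)
  hence "eventually (\<lambda>n. ?K * (exp (real D * decay n) - 1) < \<epsilon>) sequentially"
    using assms(2) by (intro order_tendstoD(2)) auto
  then obtain n where n: "?K * (exp (real D * decay n) - 1) < \<epsilon>"
    by (auto simp: eventually_sequentially)
  \<comment> \<open>Radius \<open>Suc n\<close> puts all neighbors of the balls of radius
    \<open>n\<close> inside \<Psi>, so on those balls \<open>boundary_lists\<close> is
    \<open>L\<close>.\<close>
  define \<Psi> where "\<Psi> = S \<union> (\<Union>s\<in>S. graph_ball E (Suc n) s)"
  have \<Psi>: "finite \<Psi>" "\<Psi> \<subseteq> V" "S \<subseteq> \<Psi>"
    unfolding \<Psi>_def using S(1,2) finite_graph_ball[of _ "Suc n"] graph_ball_subset[of _ "Suc n"]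
    by blast+
  have inner: "boundary_lists \<Psi> \<omega> u = L u" if "s \<in> S" "u \<in> graph_ball E n s" for \<omega> s u
  proof -
    have "neighbours E u \<subseteq> graph_ball E (Suc n) s"
      using graph_ball_neighbour[OF that(2)] by (auto simp: neighbours_def insert_commute)
    hence "neighbours E u - \<Psi> = {}" using that(1) unfolding \<Psi>_def by blast
    thus ?thesis unfolding boundary_lists_def by (simp only: image_empty Diff_empty)
  qed
  have deg: "card (nbs \<Psi> u) \<le> D" if "u \<in> \<Psi>" for u
  proof -
    have "u \<in> V" using that \<Psi> by auto
    thus ?thesis
      using degree_le[of u] card_mono[OF finite_neighbours[of u], of "nbs \<Psi> u"]
      by (auto simp: nbs_eq vertex_degree_def)
  qed
  have "\<bar>spec_prob \<Psi> \<omega> A - spec_prob \<Psi> \<omega>' A\<bar> \<le> \<epsilon>" if \<omega>: "\<omega> \<in> \<Omega>" "\<omega>' \<in> \<Omega>" for \<omega> \<omega>'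
  proof -
    have "\<bar>spec_prob \<Psi> \<omega> A - spec_prob \<Psi> \<omega>' A\<bar> =
        \<bar>\<Sum>\<xi>\<in>X. spec_prob \<Psi> \<omega> (cyl \<xi>) - spec_prob \<Psi> \<omega>' (cyl \<xi>)\<bar>"
      unfolding A_eq using spec_prob_UN[OF finX _ \<Psi>(2,1) disj] \<omega> by (simp add: sum_subtractf)
    also have "\<dots> \<le> (\<Sum>\<xi>\<in>X. \<bar>spec_prob \<Psi> \<omega> (cyl \<xi>) - spec_prob \<Psi> \<omega>' (cyl \<xi>)\<bar>)" by (rule sum_abs)
    also have "\<dots> \<le> (\<Sum>\<xi>\<in>X. real (card S) * (exp (real D * decay n) - 1))"
    proof (rule sum_mono)
      fix \<xi> show "\<bar>spec_prob \<Psi> \<omega> (cyl \<xi>) - spec_prob \<Psi> \<omega>' (cyl \<xi>)\<bar>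
          \<le> real (card S) * (exp (real D * decay n) - 1)"
        unfolding cyl_def spec_prob_eq_pattern_prob[OF \<omega>(1) \<Psi>(2,3)]
          spec_prob_eq_pattern_prob[OF \<omega>(2) \<Psi>(2,3)]
        by (rule pattern_prob_decay[OF S(1) admissible_boundary_lists[OF \<Psi>(1,2)]
              admissible_boundary_lists[OF \<Psi>(1,2)] \<Psi>(3)]) (use inner deg in auto)
    qed
    also have "\<dots> \<le> \<epsilon>" using n by simp
    finally show ?thesis .
  qed
  moreover have "A \<in> local_events \<Psi>"
    unfolding local_events_def using S(1,3) \<Psi>(3) det by blast
  ultimately show ?thesis using \<Psi> by blast
qed

lemma local_events_subset: "A \<in> local_events W \<Longrightarrow> A \<subseteq> \<Omega>"
  by (simp add: local_events_def)

lemma algebra_local_events: "algebra \<Omega> (local_events W)"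
  unfolding algebra_iff_Int
proof (intro conjI ballI)
  show "local_events W \<subseteq> Pow \<Omega>" by (auto simp: local_events_def)
  show "{} \<in> local_events W"
    by (auto simp: local_events_def determined_on_def)
  fix A assume "A \<in> local_events W"
  then obtain S where S: "finite S" "S \<subseteq> W" "A \<subseteq> \<Omega>" "determined_on S A"
    unfolding local_events_def by blast
  have "determined_on S (\<Omega> - A)"
    unfolding determined_on_def
  proof (intro ballI impI)
    fix \<omega> \<omega>' assume "\<omega> \<in> \<Omega>" "\<omega>' \<in> \<Omega>" "\<forall>s\<in>S. \<omega> s = \<omega>' s" "\<omega> \<in> \<Omega> - A"
    thus "\<omega>' \<in> \<Omega> - A" using determined_onD[OF S(4), of \<omega> \<omega>'] by simp
  qed
  thus "\<Omega> - A \<in> local_events W" unfolding local_events_def using S by blast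
  fix B assume "B \<in> local_events W"
  then obtain T where T: "finite T" "T \<subseteq> W" "B \<subseteq> \<Omega>" "determined_on T B"
    unfolding local_events_def by blast
  have "determined_on (S \<union> T) (A \<inter> B)"
    unfolding determined_on_def
  proof (intro ballI impI)
    fix \<omega> \<omega>' assume "\<omega> \<in> \<Omega>" "\<omega>' \<in> \<Omega>" "\<forall>s\<in>S \<union> T. \<omega> s = \<omega>' s" "\<omega> \<in> A \<inter> B"
    thus "\<omega>' \<in> A \<inter> B"
      using determined_onD[OF S(4), of \<omega> \<omega>'] determined_onD[OF T(4), of \<omega> \<omega>'] by simp
  qed
  moreover have "finite (S \<union> T)" "S \<union> T \<subseteq> W" "A \<inter> B \<subseteq> \<Omega>" using S T by auto
  ultimately show "A \<inter> B \<in> local_events W" unfolding local_events_def by blast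
qed

lemma local_events_Int: "A \<in> local_events W \<Longrightarrow> B \<in> local_events W \<Longrightarrow> A \<inter> B \<in> local_events W"
  using algebra_local_events[of W] by (simp add: algebra_iff_Int)

lemma Omega_in_local_events: "\<Omega> \<in> local_events W"
  using algebra_local_events[of W] by (rule algebra.top)

lemma Int_stable_local_events: "Int_stable (local_events W)"
  by (simp add: Int_stable_def local_events_Int)

lemma local_events_mono: "W \<subseteq> W' \<Longrightarrow> local_events W \<subseteq> local_events W'"
  by (auto simp: local_events_def)

lemma local_eventI:
  assumes "finite S" "S \<subseteq> W"
    and "\<And>\<omega> \<omega>'. \<omega> \<in> \<Omega> \<Longrightarrow> \<omega>' \<in> \<Omega> \<Longrightarrow> (\<And>s. s \<in> S \<Longrightarrow> \<omega> s = \<omega>' s) \<Longrightarrow> P \<omega> \<Longrightarrow> P \<omega>'"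
  shows "{\<omega> \<in> \<Omega>. P \<omega>} \<in> local_events W"
proof -
  have "determined_on S {\<omega> \<in> \<Omega>. P \<omega>}"
    unfolding determined_on_def
  proof (intro ballI impI)
    fix \<omega> \<omega>' assume "\<omega> \<in> \<Omega>" "\<omega>' \<in> \<Omega>" "\<forall>s\<in>S. \<omega> s = \<omega>' s" "\<omega> \<in> {\<omega> \<in> \<Omega>. P \<omega>}"
    thus "\<omega>' \<in> {\<omega> \<in> \<Omega>. P \<omega>}" using assms(3)[of \<omega> \<omega>'] by simp
  qed
  moreover have "{\<omega> \<in> \<Omega>. P \<omega>} \<subseteq> \<Omega>" by auto
  ultimately show ?thesis unfolding local_events_def using assms(1,2) by blast
qed

text \<open>Used with \<open>W = V\<close> for the space of colorings and with
  \<open>W = V - \<Psi>\<close> for the exterior. One inclusion says that the color maps are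
  measurable for local events. For the other, finiteness of the lists makes a local event the
  preimage of a finite set of patterns.\<close>

lemma sets_vimage_restrict:
  assumes W: "W \<subseteq> V"
  shows "sets (vimage_algebra \<Omega> (\<lambda>\<omega>. restrict \<omega> W) (\<Pi>\<^sub>M v\<in>W. count_space (L v))) =
    sigma_sets \<Omega> (local_events W)" (is "sets ?N = _")
proof
  let ?P = "\<Pi>\<^sub>M v\<in>W. count_space (L v)"
  let ?G = "sigma \<Omega> (local_events W)"
  have sub: "local_events W \<subseteq> Pow \<Omega>" using local_events_subset by auto
  have G: "space ?G = \<Omega>" "sets ?G = sigma_sets \<Omega> (local_events W)"
    using sub by (simp_all add: sets_measure_of space_measure_of)
  have L: "\<omega> v \<in> L v" if "\<omega> \<in> \<Omega>" "v \<in> V" for \<omega> v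
    using that by (auto simp: list_colorings_def PiE_iff)
  have into: "(\<lambda>\<omega>. restrict \<omega> W) \<in> \<Omega> \<rightarrow> space ?P"
    using L W by (auto simp: space_PiM)
  have "(\<lambda>\<omega>. \<omega> v) \<in> ?G \<rightarrow>\<^sub>M count_space (L v)" if v: "v \<in> W" for v
  proof (subst measurable_count_space_eq2, goal_cases)
    case 1
    show ?case using finite_list v W by auto
  next
    case 2
    have "(\<lambda>\<omega>. \<omega> v) -` {a} \<inter> \<Omega> \<in> local_events W" for a
    proof -
      have "{\<omega> \<in> \<Omega>. \<omega> v = a} \<in> local_events W"
        by (rule local_eventI[of "{v}"]) (use v in auto)
      moreover have "(\<lambda>\<omega>. \<omega> v) -` {a} \<inter> \<Omega> = {\<omega> \<in> \<Omega>. \<omega> v = a}" by auto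
      ultimately show ?thesis by simp
    qed
    thus ?case using G L v W by (auto intro: sigma_sets.Basic)
  qed
  hence meas: "(\<lambda>\<omega>. restrict \<omega> W) \<in> ?G \<rightarrow>\<^sub>M ?P"
    by (intro measurable_restrict)
  show "sets ?N \<subseteq> sigma_sets \<Omega> (local_events W)"
    unfolding sets_vimage_algebra2[OF into] using measurable_sets[OF meas] G by auto
  show "sigma_sets \<Omega> (local_events W) \<subseteq> sets ?N"
  proof (rule sets.sigma_sets_subset'[of _ ?N, simplified])
    show "local_events W \<subseteq> sets ?N"
    proof
      fix A assume "A \<in> local_events W"
      then obtain S where S: "finite S" "S \<subseteq> W" "A \<subseteq> \<Omega>" "determined_on S A"
        unfolding local_events_def by blast
      let ?Q = "\<Pi>\<^sub>M v\<in>S. count_space (L v)"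
      define X where "X = (\<lambda>\<omega>. restrict \<omega> S) ` A"
      have "X \<in> sets ?Q"
      proof (rule sets.countable)
        have "finite X" unfolding X_def
          by (rule finite_subset[OF image_mono[OF S(3)] finite_restrictions]) (use S W in auto)
        thus "countable X" by (rule countable_finite)
        fix \<xi> assume "\<xi> \<in> X"
        then obtain \<omega> where \<omega>: "\<omega> \<in> \<Omega>" "\<xi> = restrict \<omega> S" using S(3) by (auto simp: X_def)
        have "{\<xi>} = (\<Pi>\<^sub>E s\<in>S. {\<xi> s})"
        proof (intro equalityI subsetI)
          fix \<eta> assume "\<eta> \<in> (\<Pi>\<^sub>E s\<in>S. {\<xi> s})"
          hence "\<eta> \<in> extensional S" "\<And>s. s \<in> S \<Longrightarrow> \<eta> s = \<xi> s" by (auto simp: PiE_iff)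
          moreover have "\<xi> \<in> extensional S" using \<omega>(2) by simp
          ultimately show "\<eta> \<in> {\<xi>}" using extensionalityI[of \<eta> S \<xi>] by simp
        qed (use \<omega> in auto)
        also have "\<dots> \<in> sets ?Q"
          using S(1,2) W \<omega> L by (intro sets_PiM_I_finite) auto
        finally show "{\<xi>} \<in> sets ?Q" .
      qed
      hence "(\<lambda>c. restrict c S) -` X \<inter> space ?P \<in> sets ?P"
        using measurable_sets[OF measurable_restrict_subset[OF S(2)]] by blast
      moreover have "A = (\<lambda>\<omega>. restrict \<omega> W) -` ((\<lambda>c. restrict c S) -` X \<inter> space ?P) \<inter> \<Omega>"
      proof (intro equalityI subsetI)
        fix \<omega> assume "\<omega> \<in> A"
        moreover have "restrict (restrict \<omega> W) S = restrict \<omega> S" using S(2) by (auto simp: fun_eq_iff)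
        ultimately show "\<omega> \<in> (\<lambda>\<omega>. restrict \<omega> W) -` ((\<lambda>c. restrict c S) -` X \<inter> space ?P) \<inter> \<Omega>"
          using S(3) into unfolding X_def by (auto simp: subset_eq simp del: restrict_apply)
      next
        fix \<omega> assume \<omega>: "\<omega> \<in> (\<lambda>\<omega>. restrict \<omega> W) -` ((\<lambda>c. restrict c S) -` X \<inter> space ?P) \<inter> \<Omega>"
        moreover have "restrict (restrict \<omega> W) S = restrict \<omega> S" using S(2) by (auto simp: fun_eq_iff)
        ultimately obtain \<omega>' where \<omega>': "\<omega>' \<in> A" "restrict \<omega> S = restrict \<omega>' S" by (auto simp: X_def)
        have "\<omega>' s = \<omega> s" if "s \<in> S" for s using fun_cong[OF \<omega>'(2), of s] that by simp
        thus "\<omega> \<in> A" using determined_onD[OF S(4), of \<omega>' \<omega>] \<omega>' \<omega> S(3) by auto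
      qed
      ultimately show "A \<in> sets ?N" unfolding sets_vimage_algebra2[OF into] by blast
    qed
  qed (use sub sets.top[of ?N] in auto)
qed

lemma sets_coloring_space: "sets (coloring_space V E L) = sigma_sets \<Omega> (local_events V)"
proof -
  let ?P = "\<Pi>\<^sub>M v\<in>V. count_space (L v)"
  have r: "restrict \<omega> V = \<omega>" if "\<omega> \<in> \<Omega>" for \<omega>
    using that by (auto simp: list_colorings_def PiE_iff extensional_restrict)
  have into: "(\<lambda>\<omega>. restrict \<omega> V) \<in> \<Omega> \<rightarrow> space ?P"
    by (auto simp: space_PiM list_colorings_def)
  \<comment> \<open>Identifies the trace on \<Omega> with a preimage; measurability of \<Omega> in
    the product is never claimed.\<close>
  have "(\<lambda>\<omega>. restrict \<omega> V) -` A \<inter> \<Omega> = \<Omega> \<inter> A" for A using r by auto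
  hence "sets (coloring_space V E L) = sets (vimage_algebra \<Omega> (\<lambda>\<omega>. restrict \<omega> V) ?P)"
    unfolding coloring_space_def sets_restrict_space sets_vimage_algebra2[OF into] by auto
  thus ?thesis using sets_vimage_restrict[of V] by simp
qed

lemma sets_outside_algebra: "sets (outside_algebra V E L \<Psi>) = sigma_sets \<Omega> (local_events (V - \<Psi>))"
  unfolding outside_algebra_def by (rule sets_vimage_restrict) auto

lemma space_outside_algebra: "space (outside_algebra V E L \<Psi>) = \<Omega>"
  by (simp add: outside_algebra_def)

section \<open>Consistency between nested regions\<close>

lemma refill_eq:
  assumes "\<omega>' \<in> refill \<Psi> \<omega>"
  shows "refill \<Psi> \<omega>' = refill \<Psi> \<omega>"
  using assms by (auto simp: refill_def)

lemma refill_mono: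
  assumes "\<omega> \<in> refill \<Lambda> \<omega>\<^sub>0" "\<Psi> \<subseteq> \<Lambda>"
  shows "refill \<Psi> \<omega> \<subseteq> refill \<Lambda> \<omega>\<^sub>0"
proof
  fix \<omega>' assume \<omega>': "\<omega>' \<in> refill \<Psi> \<omega>"
  have "\<omega>' v = \<omega>\<^sub>0 v" if "v \<in> V - \<Lambda>" for v
  proof -
    have "v \<in> V - \<Psi>" using that assms(2) by blast
    thus ?thesis using \<omega>' assms(1) that by (simp add: refill_def)
  qed
  thus "\<omega>' \<in> refill \<Lambda> \<omega>\<^sub>0" using \<omega>' by (simp add: refill_def)
qed

text \<open>Consistency of the specification, by double counting the pairs \<open>\<omega>, \<omega>'\<close> that agree off \<open>\<Psi>\<close>.\<close>

lemma card_refill_Int_eq_sum: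
  assumes "\<omega>\<^sub>0 \<in> \<Omega>" "\<Psi> \<subseteq> \<Lambda>" "\<Lambda> \<subseteq> V" "finite \<Lambda>"
    and B: "\<And>\<omega> \<omega>'. \<omega> \<in> B \<Longrightarrow> \<omega> \<in> \<Omega> \<Longrightarrow> \<omega>' \<in> refill \<Psi> \<omega> \<Longrightarrow> \<omega>' \<in> B"
  shows "real (card (refill \<Lambda> \<omega>\<^sub>0 \<inter> (B \<inter> A))) = (\<Sum>\<omega>\<in>refill \<Lambda> \<omega>\<^sub>0 \<inter> B. spec_prob \<Psi> \<omega> A)"
proof -
  let ?X = "refill \<Lambda> \<omega>\<^sub>0 \<inter> B"
  let ?R = "refill \<Psi>"
  have finX: "finite ?X" using finite_refill[OF assms(1,3,4)] by simp
  have X\<Omega>: "\<omega> \<in> \<Omega>" if "\<omega> \<in> ?X" for \<omega> using that by (auto simp: refill_def)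
  have RX: "?R \<omega> \<subseteq> ?X" if "\<omega> \<in> ?X" for \<omega>
    using refill_mono[OF _ assms(2)] B X\<Omega>[OF that] that by blast
  have \<Psi>: "\<Psi> \<subseteq> V" "finite \<Psi>" using assms(2-4) by (auto intro: finite_subset)
  have sym: "\<omega> \<in> ?R \<omega>' \<longleftrightarrow> \<omega>' \<in> ?R \<omega>" if "\<omega> \<in> \<Omega>" "\<omega>' \<in> \<Omega>" for \<omega> \<omega>'
    using refill_eq refill_self that by blast
  \<comment> \<open>The weight is written with the class size of \<open>\<omega>'\<close>, which
    equals that of \<open>\<omega>\<close>. After the sums are swapped, each
    \<open>\<omega>'\<close> in \<open>A\<close> collects total weight 1 from its class.\<close>
  have "(\<Sum>\<omega>\<in>?X. spec_prob \<Psi> \<omega> A) =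
      (\<Sum>\<omega>\<in>?X. \<Sum>\<omega>'\<in>?X. if \<omega>' \<in> ?R \<omega> \<inter> A then 1 / real (card (?R \<omega>')) else 0)"
  proof (rule sum.cong[OF refl])
    fix \<omega> assume \<omega>: "\<omega> \<in> ?X"
    have "(\<Sum>\<omega>'\<in>?X. if \<omega>' \<in> ?R \<omega> \<inter> A then 1 / real (card (?R \<omega>')) else 0) =
        (\<Sum>\<omega>'\<in>?R \<omega> \<inter> A. 1 / real (card (?R \<omega>')))"
      using RX[OF \<omega>] finX by (intro sum.mono_neutral_cong_right) auto
    also have "\<dots> = (\<Sum>\<omega>'\<in>?R \<omega> \<inter> A. 1 / real (card (?R \<omega>)))"
      using refill_eq by (intro sum.cong) auto
    also have "\<dots> = spec_prob \<Psi> \<omega> A" by (simp add: spec_prob_def)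
    finally show "spec_prob \<Psi> \<omega> A =
        (\<Sum>\<omega>'\<in>?X. if \<omega>' \<in> ?R \<omega> \<inter> A then 1 / real (card (?R \<omega>')) else 0)" ..
  qed
  also have "\<dots> = (\<Sum>\<omega>'\<in>?X. \<Sum>\<omega>\<in>?X. if \<omega>' \<in> ?R \<omega> \<inter> A then 1 / real (card (?R \<omega>')) else 0)"
    by (rule sum.swap)
  also have "\<dots> = (\<Sum>\<omega>'\<in>?X. if \<omega>' \<in> A then 1 else 0)"
  proof (rule sum.cong[OF refl])
    fix \<omega>' assume \<omega>': "\<omega>' \<in> ?X"
    show "(\<Sum>\<omega>\<in>?X. if \<omega>' \<in> ?R \<omega> \<inter> A then 1 / real (card (?R \<omega>')) else 0) =
        (if \<omega>' \<in> A then 1 else 0)"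
    proof (cases "\<omega>' \<in> A")
      case True
      have "(\<Sum>\<omega>\<in>?X. if \<omega>' \<in> ?R \<omega> \<inter> A then 1 / real (card (?R \<omega>')) else 0) =
          (\<Sum>\<omega>\<in>?R \<omega>'. 1 / real (card (?R \<omega>')))"
      proof (rule sum.mono_neutral_cong_right)
        show "\<forall>\<omega>\<in>?X - ?R \<omega>'. (if \<omega>' \<in> ?R \<omega> \<inter> A then 1 / real (card (?R \<omega>')) else 0) = 0"
          using sym X\<Omega> \<omega>' by auto
        show "(if \<omega>' \<in> ?R \<omega> \<inter> A then 1 / real (card (?R \<omega>')) else 0) = 1 / real (card (?R \<omega>'))"
          if "\<omega> \<in> ?R \<omega>'" for \<omega>
          using sym[of \<omega> \<omega>'] X\<Omega>[OF \<omega>'] RX[OF \<omega>'] X\<Omega>[of \<omega>] that True by auto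
      qed (use finX RX[OF \<omega>'] in auto)
      also have "\<dots> = 1" using card_refill_pos[OF X\<Omega>[OF \<omega>'] \<Psi>] by simp
      finally show ?thesis using True by simp
    qed simp
  qed
  also have "\<dots> = real (card (?X \<inter> A))" using finX by (simp add: sum.If_cases)
  finally show ?thesis by (simp add: Int_assoc)
qed

section \<open>Compactness of the space of colorings\<close>

text \<open>A point outside the event is kept out by finitely many coordinates: those that determine
  the event if the point is a valid coloring, the two ends of a violated edge if it is not.\<close>

lemma closedin_local_event:
  assumes "A \<in> local_events V"
  shows "closedin (product_topology (\<lambda>v. discrete_topology (L v)) V) A"
proof -
  let ?X = "product_topology (\<lambda>v. discrete_topology (L v)) V"
  let ?T = "\<Pi>\<^sub>E v\<in>V. L v"
  obtain S where S: "finite S" "S \<subseteq> V" "A \<subseteq> \<Omega>" "determined_on S A"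
    using assms unfolding local_events_def by blast
  have top: "topspace ?X = ?T" by simp
  have A: "A \<subseteq> ?T" using S(3) by (auto simp: list_colorings_def)
  have "openin ?X (?T - A)"
    unfolding openin_product_topology_alt
  proof
    fix \<omega> assume \<omega>: "\<omega> \<in> ?T - A"
    have "\<exists>F. finite F \<and> F \<subseteq> V \<and> (\<forall>\<omega>'\<in>?T. (\<forall>v\<in>F. \<omega>' v = \<omega> v) \<longrightarrow> \<omega>' \<notin> A)"
    proof (cases "\<omega> \<in> \<Omega>")
      case True
      have "\<forall>\<omega>'\<in>?T. (\<forall>v\<in>S. \<omega>' v = \<omega> v) \<longrightarrow> \<omega>' \<notin> A"
      proof (intro ballI impI notI)
        fix \<omega>' assume "\<forall>v\<in>S. \<omega>' v = \<omega> v" "\<omega>' \<in> A"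
        thus False using determined_onD[OF S(4), of \<omega>' \<omega>] S(3) True \<omega> by auto
      qed
      thus ?thesis using S(1,2) by blast
    next
      case False
      then obtain u v where uv: "u \<in> V" "v \<in> V" "{u, v} \<in> E" "\<omega> u = \<omega> v"
        using \<omega> by (auto simp: list_colorings_def)
      have "\<forall>\<omega>'\<in>?T. (\<forall>w\<in>{u, v}. \<omega>' w = \<omega> w) \<longrightarrow> \<omega>' \<notin> A"
      proof (intro ballI impI notI)
        fix \<omega>' assume "\<forall>w\<in>{u, v}. \<omega>' w = \<omega> w" "\<omega>' \<in> A"
        moreover from this have "\<omega>' \<in> \<Omega>" using S(3) by blast
        hence "\<omega>' u \<noteq> \<omega>' v" using uv(1-3) by (simp add: list_colorings_def)
        ultimately show False using uv(4) by simp
      qed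
      thus ?thesis using uv(1,2) by (intro exI[of _ "{u, v}"]) simp
    qed
    then obtain F where F: "finite F" "F \<subseteq> V" "\<And>\<omega>'. \<omega>' \<in> ?T \<Longrightarrow> (\<forall>v\<in>F. \<omega>' v = \<omega> v) \<Longrightarrow> \<omega>' \<notin> A"
      by blast
    let ?U = "\<lambda>v. if v \<in> F then {\<omega> v} else L v"
    have "{v \<in> V. ?U v \<noteq> topspace (discrete_topology (L v))} \<subseteq> F" by auto
    hence 1: "finite {v \<in> V. ?U v \<noteq> topspace (discrete_topology (L v))}" using F(1) by (rule finite_subset)
    have 2: "\<forall>v\<in>V. openin (discrete_topology (L v)) (?U v)" using \<omega> by (auto simp: PiE_iff)
    have 3: "\<omega> \<in> (\<Pi>\<^sub>E v\<in>V. ?U v)" using \<omega> by (auto simp: PiE_iff)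
    have 4: "(\<Pi>\<^sub>E v\<in>V. ?U v) \<subseteq> ?T - A"
    proof
      fix \<omega>' assume \<omega>': "\<omega>' \<in> (\<Pi>\<^sub>E v\<in>V. ?U v)"
      have U: "\<omega>' v \<in> ?U v" if "v \<in> V" for v using \<omega>' that by (rule PiE_mem)
      have "\<omega>' v \<in> L v" if "v \<in> V" for v
        using U[OF that] \<omega> that by (cases "v \<in> F") (auto simp: PiE_iff)
      hence T: "\<omega>' \<in> ?T" using \<omega>' by (auto simp: PiE_iff)
      have "\<forall>v\<in>F. \<omega>' v = \<omega> v" using U F(2) by (metis singletonD subsetD)
      thus "\<omega>' \<in> ?T - A" using T F(3) by blast
    qed
    show "\<exists>U. finite {i \<in> V. U i \<noteq> topspace (discrete_topology (L i))} \<and>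
        (\<forall>i\<in>V. openin (discrete_topology (L i)) (U i)) \<and> \<omega> \<in> Pi\<^sub>E V U \<and> Pi\<^sub>E V U \<subseteq> ?T - A"
      using 1 2 3 4 by (intro exI[of _ ?U] conjI)
  qed
  thus ?thesis using A unfolding closedin_def top by blast
qed

text \<open>Tychonoff's theorem for the finite discrete lists, followed by the finite intersection
  property for nested closed sets.\<close>

lemma local_events_compact:
  assumes "range A \<subseteq> local_events V" "decseq A" "(\<Inter>i::nat. A i) = {}"
  shows "\<exists>i. A i = {}"
proof (rule ccontr)
  assume ne: "\<not> (\<exists>i. A i = {})"
  have "compact_space (product_topology (\<lambda>v. discrete_topology (L v)) V)"
    using finite_list by (simp add: compact_space_product_topology compact_space_discrete_topology)
  hence "(\<Inter>i. A i) \<noteq> {}"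
    by (rule compact_space_imp_nest) (use assms ne closedin_local_event in auto)
  thus False using assms(3) by contradiction
qed

end

section \<open>Existence and uniqueness of the Gibbs measure\<close>

lemma finite_image_factor:
  assumes "finite (h ` A)" "\<And>x y. x \<in> A \<Longrightarrow> y \<in> A \<Longrightarrow> h x = h y \<Longrightarrow> g x = g y"
  shows "finite (g ` A)"
proof -
  have "g ` A \<subseteq> (\<lambda>y. g (inv_into A h y)) ` (h ` A)"
  proof (rule image_subsetI)
    fix x assume x: "x \<in> A"
    have "g x = g (inv_into A h (h x))"
      using x by (intro assms(2)) (auto simp: f_inv_into_f inv_into_into)
    thus "g x \<in> (\<lambda>y. g (inv_into A h y)) ` (h ` A)" using x by blast
  qed
  thus ?thesis using assms(1) by (rule finite_subset[OF _ finite_imageI])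
qed

text \<open>Dynkin's argument for signed integrands. It reduces the characterization of a
  conditional expectation, which concerns all exterior events, to local ones.\<close>

lemma set_integral_eq_on_sigma_sets:
  fixes f g :: "'a \<Rightarrow> real"
  assumes f: "integrable M f" and g: "integrable M g"
    and G: "Int_stable G" "G \<subseteq> Pow (space M)" "space M \<in> G" "sigma_sets (space M) G \<subseteq> sets M"
    and eq: "\<And>A. A \<in> G \<Longrightarrow> (LINT x:A|M. f x) = (LINT x:A|M. g x)"
    and A: "A \<in> sigma_sets (space M) G"
  shows "(LINT x:A|M. f x) = (LINT x:A|M. g x)"
  using G(1,2) A
proof (induction rule: sigma_sets_induct_disjoint)
  case (basic A)
  thus ?case by (rule eq)
next
  case empty
  show ?case by (simp add: set_lebesgue_integral_def)
next
  case (compl A)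
  have A: "A \<in> sets M" "A \<subseteq> space M" using compl.hyps G(4) sets.sets_into_space by blast+
  have "(LINT x:(space M - A)|M. h x) = (LINT x:space M|M. h x) - (LINT x:A|M. h x)"
    if h: "integrable M h" for h :: "'a \<Rightarrow> real"
  proof -
    have int: "set_integrable M B h" if "B \<in> sets M" for B
      unfolding set_integrable_def by (rule integrable_mult_indicator[OF that h])
    have "(LINT x:A \<union> (space M - A)|M. h x) = (LINT x:A|M. h x) + (LINT x:(space M - A)|M. h x)"
      using A by (intro set_integral_Un int) auto
    moreover have "A \<union> (space M - A) = space M" using A by auto
    ultimately show ?thesis by simp
  qed
  thus ?case using f g compl.IH eq[OF G(3)] by simp
next
  case (union A)
  have A: "A i \<in> sets M" for i using union.hyps(2) G(4) by blast
  have "(LINT x:(\<Union>i. A i)|M. h x) = (\<Sum>i. LINT x:A i|M. h x)" if h: "integrable M h" for h :: "'a \<Rightarrow> real"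
  proof (rule lebesgue_integral_countable_add[OF A])
    show "A i \<inter> A j = {}" if "i \<noteq> j" for i j
      using union.hyps(1) that by (auto simp: disjoint_family_on_def)
    have "(\<Union>i. A i) \<in> sets M" using A by auto
    thus "set_integrable M (\<Union>i. A i) h"
      unfolding set_integrable_def by (rule integrable_mult_indicator[OF _ h])
  qed
  thus ?case using f g union.IH by simp
qed

section \<open>The infinite-volume limit\<close>

context sparse_graph
begin

text \<open>By consistency the probability for the larger region is an average of those for the
  smaller one, so a bound uniform in the boundary condition is inherited.\<close>

lemma spec_prob_near:
  assumes "\<omega>\<^sub>0 \<in> \<Omega>" "\<Psi> \<subseteq> \<Lambda>" "\<Lambda> \<subseteq> V" "finite \<Lambda>"
    and near: "\<And>\<omega>. \<omega> \<in> \<Omega> \<Longrightarrow> \<bar>spec_prob \<Psi> \<omega> A - c\<bar> \<le> \<epsilon>"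
  shows "\<bar>spec_prob \<Lambda> \<omega>\<^sub>0 A - c\<bar> \<le> \<epsilon>"
proof -
  let ?R = "refill \<Lambda> \<omega>\<^sub>0"
  let ?N = "real (card ?R)"
  have N: "?N > 0" using card_refill_pos[OF assms(1,3,4)] by simp
  have "real (card (?R \<inter> A)) = (\<Sum>\<omega>\<in>?R. spec_prob \<Psi> \<omega> A)"
    using card_refill_Int_eq_sum[OF assms(1-4), of UNIV A] by simp
  hence eq: "spec_prob \<Lambda> \<omega>\<^sub>0 A - c = (\<Sum>\<omega>\<in>?R. spec_prob \<Psi> \<omega> A - c) / ?N"
    using N by (simp add: spec_prob_def[of \<Lambda>] sum_subtractf field_simps)
  have "\<bar>\<Sum>\<omega>\<in>?R. spec_prob \<Psi> \<omega> A - c\<bar> \<le> (\<Sum>\<omega>\<in>?R. \<bar>spec_prob \<Psi> \<omega> A - c\<bar>)" by (rule sum_abs)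
  also have "\<dots> \<le> (\<Sum>\<omega>\<in>?R. \<epsilon>)" using near by (intro sum_mono) (auto simp: refill_def)
  finally show ?thesis unfolding eq abs_divide using N by (simp add: divide_le_eq mult.commute)
qed

definition base :: "'v \<Rightarrow> nat" where
  "base = (SOME \<omega>. \<omega> \<in> \<Omega>)"

lemma base_in_Omega: "base \<in> \<Omega>"
  unfolding base_def using Omega_nonempty by (simp add: some_in_eq)

text \<open>A limit along all finite subsets, since an uncountable \<open>V\<close> has no
  exhaustion by a sequence of finite regions.\<close>

definition limit_prob :: "('v \<Rightarrow> nat) set \<Rightarrow> real" where
  "limit_prob A = Lim (finite_subsets_at_top V) (\<lambda>\<Lambda>. spec_prob \<Lambda> base A)"

lemma eventually_superset:
  assumes "finite \<Psi>" "\<Psi> \<subseteq> V"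
  shows "eventually (\<lambda>\<Lambda>. finite \<Lambda> \<and> \<Psi> \<subseteq> \<Lambda> \<and> \<Lambda> \<subseteq> V) (finite_subsets_at_top V)"
  using assms by (auto simp: eventually_finite_subsets_at_top)

lemma tendsto_limit_prob:
  assumes "A \<in> local_events V"
  shows "((\<lambda>\<Lambda>. spec_prob \<Lambda> base A) \<longlongrightarrow> limit_prob A) (finite_subsets_at_top V)"
proof -
  let ?F = "finite_subsets_at_top V"
  let ?f = "\<lambda>\<Lambda>. spec_prob \<Lambda> base A"
  have "cauchy_filter (filtermap ?f ?F)"
    unfolding cauchy_filter_metric_filtermap
  proof (intro allI impI)
    fix e :: real assume "e > 0"
    \<comment> \<open>Two large regions are compared through the same \<Psi>, so the error is
      \<open>2 * e / 3 < e\<close>.\<close>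
    hence "e / 3 > 0" by simp
    from spec_prob_decay[OF assms this] obtain \<Psi> where \<Psi>: "finite \<Psi>" "\<Psi> \<subseteq> V"
      "\<forall>\<omega>\<in>\<Omega>. \<forall>\<omega>'\<in>\<Omega>. \<bar>spec_prob \<Psi> \<omega> A - spec_prob \<Psi> \<omega>' A\<bar> \<le> e / 3" by blast
    have near: "\<bar>?f \<Lambda> - spec_prob \<Psi> base A\<bar> \<le> e / 3" if "finite \<Lambda> \<and> \<Psi> \<subseteq> \<Lambda> \<and> \<Lambda> \<subseteq> V" for \<Lambda>
    proof (rule spec_prob_near[OF base_in_Omega])
      show "\<bar>spec_prob \<Psi> \<omega> A - spec_prob \<Psi> base A\<bar> \<le> e / 3" if "\<omega> \<in> \<Omega>" for \<omega>
        using \<Psi>(3) base_in_Omega that by blast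
    qed (use that in simp_all)
    show "\<exists>P. eventually P ?F \<and> (\<forall>x y. P x \<and> P y \<longrightarrow> dist (?f x) (?f y) < e)"
    proof (intro exI[of _ "\<lambda>\<Lambda>. finite \<Lambda> \<and> \<Psi> \<subseteq> \<Lambda> \<and> \<Lambda> \<subseteq> V"] conjI allI impI)
      show "eventually (\<lambda>\<Lambda>. finite \<Lambda> \<and> \<Psi> \<subseteq> \<Lambda> \<and> \<Lambda> \<subseteq> V) ?F" by (rule eventually_superset[OF \<Psi>(1,2)])
      fix x y assume "(finite x \<and> \<Psi> \<subseteq> x \<and> x \<subseteq> V) \<and> (finite y \<and> \<Psi> \<subseteq> y \<and> y \<subseteq> V)"
      thus "dist (?f x) (?f y) < e"
        using near[of x] near[of y] \<open>e > 0\<close> unfolding dist_real_def by linarith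
    qed
  qed
  hence "\<exists>l. filtermap ?f ?F \<le> nhds l"
    by (rule cauchy_filter_complete_converges[OF _ complete_UNIV]) (auto simp: filtermap_bot_iff)
  then obtain l where l: "(?f \<longlongrightarrow> l) ?F" by (auto simp: filterlim_def)
  thus ?thesis unfolding limit_prob_def using tendsto_Lim[OF finite_subsets_at_top_neq_bot l] by simp
qed

text \<open>Carries to the limit any finite-volume identity that holds for all regions containing
  some finite \<Psi>.\<close>

lemma limit_prob_eqI:
  assumes "A \<in> local_events V" "finite \<Psi>" "\<Psi> \<subseteq> V"
    and "(f \<longlongrightarrow> l) (finite_subsets_at_top V)"
    and "\<And>\<Lambda>. finite \<Lambda> \<Longrightarrow> \<Psi> \<subseteq> \<Lambda> \<Longrightarrow> \<Lambda> \<subseteq> V \<Longrightarrow> spec_prob \<Lambda> base A = f \<Lambda>"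
  shows "limit_prob A = l"
proof (rule tendsto_unique[OF finite_subsets_at_top_neq_bot _ assms(4)])
  have "eventually (\<lambda>\<Lambda>. spec_prob \<Lambda> base A = f \<Lambda>) (finite_subsets_at_top V)"
    using eventually_superset[OF assms(2,3)] by eventually_elim (use assms(5) in blast)
  thus "(f \<longlongrightarrow> limit_prob A) (finite_subsets_at_top V)"
    by (rule tendsto_cong[THEN iffD1, OF _ tendsto_limit_prob[OF assms(1)]])
qed

lemma limit_prob_empty: "limit_prob {} = 0"
  using algebra_local_events[of V]
  by (intro limit_prob_eqI[of _ "{}" "\<lambda>_. 0"]) (auto simp: spec_prob_def algebra_iff_Int)

lemma limit_prob_Omega: "limit_prob \<Omega> = 1"
proof (rule limit_prob_eqI[OF Omega_in_local_events, of "{}" "\<lambda>_. 1"])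
  fix \<Lambda> assume "finite \<Lambda>" "\<Lambda> \<subseteq> V"
  moreover have "refill \<Lambda> base \<inter> \<Omega> = refill \<Lambda> base" by (auto simp: refill_def)
  ultimately show "spec_prob \<Lambda> base \<Omega> = 1"
    using card_refill_pos[OF base_in_Omega, of \<Lambda>] by (simp add: spec_prob_def)
qed auto

lemma limit_prob_nonneg:
  assumes "A \<in> local_events V"
  shows "limit_prob A \<ge> 0"
  using tendsto_limit_prob[OF assms]
  by (rule tendsto_lowerbound) (auto simp: spec_prob_def)

lemma limit_prob_Un:
  assumes "A \<in> local_events V" "B \<in> local_events V" "A \<inter> B = {}"
  shows "limit_prob (A \<union> B) = limit_prob A + limit_prob B"
proof (rule limit_prob_eqI[of _ "{}"])
  show "A \<union> B \<in> local_events V" using algebra_local_events[of V] assms by (auto simp: algebra_iff_Un)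
  show "((\<lambda>\<Lambda>. spec_prob \<Lambda> base A + spec_prob \<Lambda> base B) \<longlongrightarrow> limit_prob A + limit_prob B)
      (finite_subsets_at_top V)"
    using assms by (intro tendsto_add tendsto_limit_prob)
  fix \<Lambda> assume \<Lambda>: "finite \<Lambda>" "\<Lambda> \<subseteq> V"
  have "refill \<Lambda> base \<inter> (A \<union> B) = (refill \<Lambda> base \<inter> A) \<union> (refill \<Lambda> base \<inter> B)" by auto
  moreover have "(refill \<Lambda> base \<inter> A) \<inter> (refill \<Lambda> base \<inter> B) = {}" using assms(3) by auto
  ultimately have "card (refill \<Lambda> base \<inter> (A \<union> B)) =
      card (refill \<Lambda> base \<inter> A) + card (refill \<Lambda> base \<inter> B)"
    using finite_refill[OF base_in_Omega \<Lambda>(2,1)] by (simp add: card_Un_disjoint)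
  thus "spec_prob \<Lambda> base (A \<union> B) = spec_prob \<Lambda> base A + spec_prob \<Lambda> base B"
    by (simp add: spec_prob_def add_divide_distrib)
qed auto

text \<open>Caratheodory extension. Continuity at the empty set is immediate because, by
  compactness, a decreasing sequence of local events with empty intersection is eventually
  empty.\<close>

lemma limit_measure_exists:
  "\<exists>\<mu>. prob_space \<mu> \<and> sets \<mu> = sets (coloring_space V E L) \<and>
    (\<forall>A\<in>local_events V. measure \<mu> A = limit_prob A)"
proof -
  interpret algebra \<Omega> "local_events V" by (rule algebra_local_events)
  let ?f = "\<lambda>A. ennreal (limit_prob A)"
  have "\<exists>m. (\<forall>A\<in>local_events V. m A = ?f A) \<and> measure_space \<Omega> (sigma_sets \<Omega> (local_events V)) m"
  proof (rule caratheodory_empty_continuous)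
    show "positive (local_events V) ?f" by (simp add: positive_def limit_prob_empty)
    show "additive (local_events V) ?f"
      by (simp add: additive_def limit_prob_Un limit_prob_nonneg)
    show "(\<lambda>i. ?f (A i)) \<longlonglongrightarrow> 0"
      if A: "range A \<subseteq> local_events V" "decseq A" "(\<Inter>i. A i) = {}" for A
    proof -
      obtain i where i: "A i = {}" using local_events_compact[OF A] by blast
      have "A j = {}" if "j \<ge> i" for j using A(2) i that by (auto dest: decseqD)
      hence "eventually (\<lambda>j. ?f (A j) = 0) sequentially"
        unfolding eventually_sequentially using limit_prob_empty by (intro exI[of _ i]) simp
      thus ?thesis by (rule tendsto_eventually)
    qed
  qed simp
  then obtain m where m: "\<And>A. A \<in> local_events V \<Longrightarrow> m A = ?f A"
    "measure_space \<Omega> (sigma_sets \<Omega> (local_events V)) m" by blast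
  define \<mu> where "\<mu> = measure_of \<Omega> (local_events V) m"
  have sub: "local_events V \<subseteq> Pow \<Omega>" using local_events_subset by auto
  have sets: "sets \<mu> = sigma_sets \<Omega> (local_events V)" and space: "space \<mu> = \<Omega>"
    unfolding \<mu>_def using sub by (simp_all add: sets_measure_of space_measure_of)
  have emeasure: "emeasure \<mu> A = ?f A" if "A \<in> local_events V" for A
  proof -
    have "emeasure \<mu> A = m A"
      using m(2) that sets by (intro emeasure_measure_of[OF \<mu>_def sub]) (auto simp: measure_space_def)
    thus ?thesis using m(1)[OF that] by simp
  qed
  have "prob_space \<mu>"
    by (rule prob_spaceI) (simp add: space emeasure[OF Omega_in_local_events] limit_prob_Omega)
  moreover have "measure \<mu> A = limit_prob A" if "A \<in> local_events V" for A
    using emeasure[OF that] limit_prob_nonneg[OF that] by (simp add: measure_def)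
  ultimately show ?thesis using sets sets_coloring_space by auto
qed

section \<open>Conditional probabilities of the limit measure\<close>

definition outer_boundary :: "'v set \<Rightarrow> 'v set" where
  "outer_boundary \<Psi> = (\<Union>u\<in>\<Psi>. neighbours E u) - \<Psi>"

lemma outer_boundary:
  assumes "finite \<Psi>" "\<Psi> \<subseteq> V"
  shows "finite (outer_boundary \<Psi>)" "outer_boundary \<Psi> \<subseteq> V - \<Psi>"
  using assms finite_neighbours neighbours_subset unfolding outer_boundary_def by blast+

abbreviation pattern_event :: "'v set \<Rightarrow> ('v \<Rightarrow> nat) \<Rightarrow> ('v \<Rightarrow> nat) set" where
  "pattern_event \<Psi> \<xi> \<equiv> {\<omega> \<in> \<Omega>. restrict \<omega> \<Psi> = \<xi>}"

lemma pattern_event_local: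
  assumes "finite \<Psi>" "\<Psi> \<subseteq> W"
  shows "pattern_event \<Psi> \<xi> \<in> local_events W"
proof (rule local_eventI[OF assms])
  fix \<omega> \<omega>' assume "\<And>s. s \<in> \<Psi> \<Longrightarrow> \<omega> s = \<omega>' s" "restrict \<omega> \<Psi> = \<xi>"
  moreover from this have "restrict \<omega> \<Psi> = restrict \<omega>' \<Psi>" by (intro restrict_ext) simp
  ultimately show "restrict \<omega>' \<Psi> = \<xi>" by simp
qed

lemma spec_prob_local:
  assumes "finite \<Psi>" "\<Psi> \<subseteq> V"
  shows "{\<omega> \<in> \<Omega>. spec_prob \<Psi> \<omega> (pattern_event \<Psi> \<xi>) \<in> M} \<in> local_events (V - \<Psi>)"
proof (rule local_eventI[OF outer_boundary[OF assms]])
  fix \<omega> \<omega>' assume "\<omega> \<in> \<Omega>" "\<omega>' \<in> \<Omega>" "\<And>s. s \<in> outer_boundary \<Psi> \<Longrightarrow> \<omega> s = \<omega>' s"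
    "spec_prob \<Psi> \<omega> (pattern_event \<Psi> \<xi>) \<in> M"
  thus "spec_prob \<Psi> \<omega>' (pattern_event \<Psi> \<xi>) \<in> M"
    using spec_prob_cong[of \<Psi> \<omega> \<omega>' \<xi>] assms(2) by (simp add: outer_boundary_def)
qed

text \<open>By the Markov property and finiteness of the lists, the specification is a simple
  function of the exterior, so its integrals are finite sums of probabilities of local
  events.\<close>

lemma finite_spec_prob_values:
  assumes "finite \<Psi>" "\<Psi> \<subseteq> V"
  shows "finite ((\<lambda>\<omega>. spec_prob \<Psi> \<omega> (pattern_event \<Psi> \<xi>)) ` \<Omega>)"
proof (rule finite_image_factor)
  show "finite ((\<lambda>\<omega>. restrict \<omega> (outer_boundary \<Psi>)) ` \<Omega>)"
    using outer_boundary[OF assms] by (intro finite_restrictions) auto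
  fix \<omega> \<omega>' assume \<omega>: "\<omega> \<in> \<Omega>" "\<omega>' \<in> \<Omega>"
    and "restrict \<omega> (outer_boundary \<Psi>) = restrict \<omega>' (outer_boundary \<Psi>)"
  hence "\<omega> v = \<omega>' v" if "v \<in> outer_boundary \<Psi>" for v using that by (metis restrict_apply')
  thus "spec_prob \<Psi> \<omega> (pattern_event \<Psi> \<xi>) = spec_prob \<Psi> \<omega>' (pattern_event \<Psi> \<xi>)"
    using \<omega> assms(2) by (intro spec_prob_cong) (auto simp: outer_boundary_def)
qed

text \<open>The Dobrushin-Lanford-Ruelle equation with its integral written as a finite sum over the
  values of \<open>g\<close>. In finite volume it is consistency with the colorings grouped by the
  value of \<open>g\<close>; finiteness of the sum lets the limit pass inside.\<close>

lemma limit_prob_DLR: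
  fixes \<xi> :: "'v \<Rightarrow> nat"
  assumes \<Psi>: "finite \<Psi>" "\<Psi> \<subseteq> V" and B: "B \<in> local_events (V - \<Psi>)"
  defines "g \<equiv> \<lambda>\<omega>. spec_prob \<Psi> \<omega> (pattern_event \<Psi> \<xi>)"
  shows "limit_prob (B \<inter> pattern_event \<Psi> \<xi>) = (\<Sum>r\<in>g ` \<Omega>. r * limit_prob (B \<inter> {\<omega> \<in> \<Omega>. g \<omega> = r}))"
proof (rule limit_prob_eqI[OF _ \<Psi>])
  have BV: "B \<in> local_events V" using B local_events_mono[of "V - \<Psi>" V] by auto
  thus "B \<inter> pattern_event \<Psi> \<xi> \<in> local_events V" using \<Psi> by (intro local_events_Int pattern_event_local)
  have "{\<omega> \<in> \<Omega>. g \<omega> = r} \<in> local_events V" for r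
    using spec_prob_local[OF \<Psi>, of \<xi> "{r}"] local_events_mono[of "V - \<Psi>" V] by (auto simp: g_def)
  thus "((\<lambda>\<Lambda>. \<Sum>r\<in>g ` \<Omega>. r * spec_prob \<Lambda> base (B \<inter> {\<omega> \<in> \<Omega>. g \<omega> = r})) \<longlongrightarrow>
      (\<Sum>r\<in>g ` \<Omega>. r * limit_prob (B \<inter> {\<omega> \<in> \<Omega>. g \<omega> = r}))) (finite_subsets_at_top V)"
    using BV by (intro tendsto_sum tendsto_mult tendsto_const tendsto_limit_prob local_events_Int)
  fix \<Lambda> assume \<Lambda>: "finite \<Lambda>" "\<Psi> \<subseteq> \<Lambda>" "\<Lambda> \<subseteq> V"
  let ?R = "refill \<Lambda> base"
  have finR: "finite ?R" by (rule finite_refill[OF base_in_Omega \<Lambda>(3,1)])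
  obtain S where S: "S \<subseteq> V - \<Psi>" "B \<subseteq> \<Omega>" "determined_on S B"
    using B unfolding local_events_def by blast
  \<comment> \<open>\<open>B\<close> is decided off \<Psi>, hence is a union of recoloring classes,
    as the double counting requires.\<close>
  have "\<omega>' \<in> B" if "\<omega> \<in> B" "\<omega> \<in> \<Omega>" "\<omega>' \<in> refill \<Psi> \<omega>" for \<omega> \<omega>'
  proof -
    have "\<omega> s = \<omega>' s" if "s \<in> S" for s
      using \<open>\<omega>' \<in> refill \<Psi> \<omega>\<close> S(1) that by (auto simp: refill_def)
    thus ?thesis using determined_onD[OF S(3), of \<omega> \<omega>'] that by (simp add: refill_def)
  qed
  hence "real (card (?R \<inter> (B \<inter> pattern_event \<Psi> \<xi>))) = (\<Sum>\<omega>\<in>?R \<inter> B. g \<omega>)"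
    unfolding g_def by (rule card_refill_Int_eq_sum[OF base_in_Omega \<Lambda>(2,3,1)])
  also have "\<dots> = (\<Sum>r\<in>g ` \<Omega>. \<Sum>\<omega>\<in>{\<omega> \<in> ?R \<inter> B. g \<omega> = r}. g \<omega>)"
    using finR finite_spec_prob_values[OF \<Psi>, of \<xi>]
    by (intro sum.group[symmetric]) (auto simp: g_def refill_def)
  also have "\<dots> = (\<Sum>r\<in>g ` \<Omega>. r * real (card (?R \<inter> (B \<inter> {\<omega> \<in> \<Omega>. g \<omega> = r}))))"
  proof (rule sum.cong[OF refl])
    fix r
    have "{\<omega> \<in> ?R \<inter> B. g \<omega> = r} = ?R \<inter> (B \<inter> {\<omega> \<in> \<Omega>. g \<omega> = r})" using S(2) by auto
    moreover have "(\<Sum>\<omega>\<in>{\<omega> \<in> ?R \<inter> B. g \<omega> = r}. g \<omega>) = (\<Sum>\<omega>\<in>{\<omega> \<in> ?R \<inter> B. g \<omega> = r}. r)"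
      by (rule sum.cong) auto
    ultimately show "(\<Sum>\<omega>\<in>{\<omega> \<in> ?R \<inter> B. g \<omega> = r}. g \<omega>) =
        r * real (card (?R \<inter> (B \<inter> {\<omega> \<in> \<Omega>. g \<omega> = r})))" by simp
  qed
  finally show "spec_prob \<Lambda> base (B \<inter> pattern_event \<Psi> \<xi>) =
      (\<Sum>r\<in>g ` \<Omega>. r * spec_prob \<Lambda> base (B \<inter> {\<omega> \<in> \<Omega>. g \<omega> = r}))"
    by (simp add: spec_prob_def[of \<Lambda>] sum_divide_distrib)
qed

text \<open>The specification is bounded and measurable with respect to the exterior, so it is the
  conditional expectation once the set integrals agree. \<open>limit_prob_DLR\<close> gives this for
  local exterior events, and Dynkin's argument extends it.\<close>

lemma gibbs_measure_exists: "\<exists>\<mu>. gibbs_measure V E L \<mu>"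
proof -
  obtain \<mu> where \<mu>: "prob_space \<mu>" "sets \<mu> = sets (coloring_space V E L)"
    "\<And>A. A \<in> local_events V \<Longrightarrow> measure \<mu> A = limit_prob A"
    using limit_measure_exists by blast
  interpret prob_space \<mu> by (rule \<mu>(1))
  have space: "space \<mu> = \<Omega>" using sets_eq_imp_space_eq[OF \<mu>(2)] by (simp add: space_coloring_space)
  have local_sets: "A \<in> sets \<mu>" if "A \<in> local_events V" for A
    using that unfolding \<mu>(2) sets_coloring_space by (rule sigma_sets.Basic)
  have "AE \<omega> in \<mu>. real_cond_exp \<mu> (outside_algebra V E L \<Psi>)
      (indicator {\<omega>' \<in> space \<mu>. restrict \<omega>' \<Psi> = \<xi>}) \<omega> =
      pmf (uniform_spec V E L \<Psi> (restrict \<omega> (V - \<Psi>))) \<xi>"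
    if \<Psi>: "finite \<Psi>" "\<Psi> \<subseteq> V" for \<Psi> \<xi>
  proof -
    let ?F = "outside_algebra V E L \<Psi>"
    have subalg: "subalgebra \<mu> ?F" by (rule subalgebra_outside_algebra[OF \<mu>(2)])
    interpret F: finite_measure_subalgebra \<mu> ?F by unfold_locales (rule subalg)
    let ?A = "pattern_event \<Psi> \<xi>"
    define f :: "('v \<Rightarrow> nat) \<Rightarrow> real" where "f = indicator ?A"
    define g where "g \<omega> = spec_prob \<Psi> \<omega> ?A" for \<omega>
    have A: "?A \<in> local_events V" by (rule pattern_event_local[OF \<Psi>])
    have f: "integrable \<mu> f" unfolding f_def using local_sets[OF A] by (simp add: integrable_indicator_iff emeasure_eq_measure)
    have gF: "g \<in> borel_measurable ?F"
    proof (rule measurableI)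
      fix M :: "real set"
      have "g -` M \<inter> space ?F = {\<omega> \<in> \<Omega>. g \<omega> \<in> M}" by (auto simp: space_outside_algebra)
      thus "g -` M \<inter> space ?F \<in> sets ?F"
        unfolding sets_outside_algebra g_def using spec_prob_local[OF \<Psi>] by (simp add: sigma_sets.Basic)
    qed simp
    hence g_meas: "g \<in> borel_measurable \<mu>" using subalg measurable_from_subalg by blast
    have "norm (g \<omega>) \<le> 1" if "\<omega> \<in> space \<mu>" for \<omega>
      using that space spec_prob_eq_pmf[of \<omega> \<Psi> \<xi>] \<Psi> by (simp add: g_def pmf_le_1)
    hence g: "integrable \<mu> g"
      using g_meas by (intro integrable_const_bound[of _ 1]) auto
    have level: "{\<omega> \<in> \<Omega>. g \<omega> = r} \<in> local_events V" for r
      using spec_prob_local[OF \<Psi>, of \<xi> "{r}"] local_events_mono[of "V - \<Psi>" V] by (auto simp: g_def)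
    have DLR: "(LINT \<omega>:B|\<mu>. f \<omega>) = (LINT \<omega>:B|\<mu>. g \<omega>)" if B: "B \<in> local_events (V - \<Psi>)" for B
    proof -
      have BV: "B \<in> local_events V" using B local_events_mono[of "V - \<Psi>" V] by auto
      let ?C = "\<lambda>r. B \<inter> {\<omega> \<in> \<Omega>. g \<omega> = r}"
      have C: "?C r \<in> local_events V" for r using local_events_Int[OF BV level] .
      have fin: "finite (g ` \<Omega>)" unfolding g_def by (rule finite_spec_prob_values[OF \<Psi>])
      have "(LINT \<omega>:B|\<mu>. g \<omega>) = (LINT \<omega>|\<mu>. (\<Sum>r\<in>g ` \<Omega>. r * indicator (?C r) \<omega>))"
        unfolding set_lebesgue_integral_def
      proof (rule Bochner_Integration.integral_cong[OF refl])
        fix \<omega> assume "\<omega> \<in> space \<mu>"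
        hence \<omega>: "\<omega> \<in> \<Omega>" by (simp add: space)
        have "(\<Sum>r\<in>g ` \<Omega>. r * indicator (?C r) \<omega>) = 
            (\<Sum>r\<in>g ` \<Omega>. if r = g \<omega> then indicator B \<omega> * g \<omega> else 0)"
          using \<omega> by (intro sum.cong) (auto simp: indicator_def)
        also have "\<dots> = indicator B \<omega> *\<^sub>R g \<omega>"
          using fin \<omega> by (subst sum.delta) auto
        finally show "indicator B \<omega> *\<^sub>R g \<omega> = (\<Sum>r\<in>g ` \<Omega>. r * indicator (?C r) \<omega>)" ..
      qed
      also have "\<dots> = (\<Sum>r\<in>g ` \<Omega>. r * measure \<mu> (?C r))"
      proof -
        have "integrable \<mu> (\<lambda>\<omega>. r * indicator (?C r) \<omega>)" for r :: real
          using local_sets[OF C] by (intro integrable_mult_right) (simp add: integrable_indicator_iff emeasure_eq_measure)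
        moreover have "?C r \<inter> space \<mu> = ?C r" for r using space by auto
        ultimately show ?thesis by (simp add: Bochner_Integration.integral_sum)
      qed
      also have "\<dots> = measure \<mu> (B \<inter> ?A)"
        using limit_prob_DLR[OF \<Psi> B, of \<xi>] \<mu>(3)[OF C] \<mu>(3)[OF local_events_Int[OF BV A]]
        by (simp add: g_def)
      also have "\<dots> = (LINT \<omega>:B|\<mu>. f \<omega>)"
      proof -
        have "B \<inter> ?A \<inter> space \<mu> = B \<inter> ?A" using space by auto
        moreover have "indicator B \<omega> *\<^sub>R f \<omega> = indicator (B \<inter> ?A) \<omega>" for \<omega>
          by (simp add: f_def indicator_inter_arith)
        ultimately show ?thesis unfolding set_lebesgue_integral_def by simp
      qed
      finally show ?thesis ..
    qed
    have "(LINT \<omega>:B|\<mu>. f \<omega>) = (LINT \<omega>:B|\<mu>. g \<omega>)" if "B \<in> sets ?F" for B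
    proof (rule set_integral_eq_on_sigma_sets[OF f g Int_stable_local_events])
      show "local_events (V - \<Psi>) \<subseteq> Pow (space \<mu>)" "space \<mu> \<in> local_events (V - \<Psi>)"
        unfolding space using local_events_subset Omega_in_local_events by blast+
      show "sigma_sets (space \<mu>) (local_events (V - \<Psi>)) \<subseteq> sets \<mu>"
        using subalg unfolding subalgebra_def sets_outside_algebra space by simp
      show "B \<in> sigma_sets (space \<mu>) (local_events (V - \<Psi>))"
        using that unfolding sets_outside_algebra space .
    qed (rule DLR)
    hence "AE \<omega> in \<mu>. real_cond_exp \<mu> ?F f \<omega> = g \<omega>"
      by (rule F.real_cond_exp_charact[OF _ f g gF])
    thus ?thesis
    proof (rule AE_mp[OF _ AE_I2], intro impI)
      fix \<omega> assume "\<omega> \<in> space \<mu>" "real_cond_exp \<mu> ?F f \<omega> = g \<omega>"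
      thus "real_cond_exp \<mu> ?F (indicator {\<omega>' \<in> space \<mu>. restrict \<omega>' \<Psi> = \<xi>}) \<omega> =
          pmf (uniform_spec V E L \<Psi> (restrict \<omega> (V - \<Psi>))) \<xi>"
        using spec_prob_eq_pmf[of \<omega> \<Psi> \<xi>] \<Psi> by (simp add: f_def g_def space)
    qed
  qed
  thus ?thesis using \<mu>(1,2) unfolding gibbs_measure_def by blast
qed

section \<open>Uniqueness\<close>

text \<open>Integrating the conditional probabilities shows that the measure of \<open>A\<close> is
  an average of \<open>spec_prob \<Psi> \<omega> A\<close>. The event is split into patterns on
  \<Psi> because the Gibbs property is stated for one pattern at a time.\<close>

lemma gibbs_measure_near:
  assumes gibbs: "gibbs_measure V E L \<mu>" and \<Psi>: "finite \<Psi>" "\<Psi> \<subseteq> V"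
    and A: "A \<in> local_events \<Psi>" and near: "\<And>\<omega>. \<omega> \<in> \<Omega> \<Longrightarrow> \<bar>spec_prob \<Psi> \<omega> A - c\<bar> \<le> \<epsilon>"
  shows "\<bar>measure \<mu> A - c\<bar> \<le> \<epsilon>"
proof -
  have sets: "sets \<mu> = sets (coloring_space V E L)" and "prob_space \<mu>"
    using gibbs by (auto simp: gibbs_measure_def)
  interpret prob_space \<mu> by fact
  have space: "space \<mu> = \<Omega>" using sets_eq_imp_space_eq[OF sets] by (simp add: space_coloring_space)
  let ?F = "outside_algebra V E L \<Psi>"
  interpret F: finite_measure_subalgebra \<mu> ?F
    by unfold_locales (rule subalgebra_outside_algebra[OF sets])
  obtain S where S: "S \<subseteq> \<Psi>" "A \<subseteq> \<Omega>" "determined_on S A"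
    using A unfolding local_events_def by blast
  define X where "X = (\<lambda>\<omega>. restrict \<omega> \<Psi>) ` A"
  have finX: "finite X" unfolding X_def
    by (rule finite_subset[OF image_mono[OF S(2)] finite_restrictions[OF \<Psi>]])
  \<comment> \<open>The Gibbs property quantifies over valid patterns only, so those occurring in
    \<open>A\<close> must be shown valid.\<close>
  have XC: "\<xi> \<in> list_colorings E L \<Psi>" if "\<xi> \<in> X" for \<xi>
  proof -
    obtain \<omega> where "\<omega> \<in> \<Omega>" "\<xi> = restrict \<omega> \<Psi>" using \<open>\<xi> \<in> X\<close> S(2) by (auto simp: X_def)
    thus ?thesis using \<Psi>(2) by (auto simp: list_colorings_def subset_eq)
  qed
  have A_eq: "A = (\<Union>\<xi>\<in>X. pattern_event \<Psi> \<xi>)"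
  proof (intro equalityI subsetI)
    fix \<omega> assume "\<omega> \<in> A"
    thus "\<omega> \<in> (\<Union>\<xi>\<in>X. pattern_event \<Psi> \<xi>)" using S(2) by (auto simp: X_def)
  next
    fix \<omega> assume "\<omega> \<in> (\<Union>\<xi>\<in>X. pattern_event \<Psi> \<xi>)"
    then obtain \<omega>' where \<omega>': "\<omega> \<in> \<Omega>" "\<omega>' \<in> A" "restrict \<omega> \<Psi> = restrict \<omega>' \<Psi>" by (auto simp: X_def)
    have "\<omega>' s = \<omega> s" if "s \<in> S" for s using fun_cong[OF \<omega>'(3), of s] that S(1) by auto
    thus "\<omega> \<in> A" using determined_onD[OF S(3), of \<omega>' \<omega>] \<omega>' S(2) by auto
  qed
  have P: "pattern_event \<Psi> \<xi> \<in> sets \<mu>" for \<xi>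
    unfolding sets sets_coloring_space by (rule sigma_sets.Basic[OF pattern_event_local[OF \<Psi>]])
  define h where "h \<xi> = real_cond_exp \<mu> ?F (indicator (pattern_event \<Psi> \<xi>))" for \<xi>
  have ind: "integrable \<mu> (indicator (pattern_event \<Psi> \<xi>) :: _ \<Rightarrow> real)" for \<xi>
    using P by (simp add: integrable_indicator_iff emeasure_eq_measure)
  have h: "integrable \<mu> (h \<xi>)" "(LINT \<omega>|\<mu>. h \<xi> \<omega>) = measure \<mu> (pattern_event \<Psi> \<xi>)" for \<xi>
  proof -
    show "integrable \<mu> (h \<xi>)" unfolding h_def by (rule F.real_cond_exp_int(1)[OF ind])
    have "pattern_event \<Psi> \<xi> \<inter> space \<mu> = pattern_event \<Psi> \<xi>" using space by auto
    thus "(LINT \<omega>|\<mu>. h \<xi> \<omega>) = measure \<mu> (pattern_event \<Psi> \<xi>)"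
      unfolding h_def F.real_cond_exp_int(2)[OF ind] by simp
  qed
  have "measure \<mu> A = (\<Sum>\<xi>\<in>X. measure \<mu> (pattern_event \<Psi> \<xi>))"
    unfolding A_eq using P finX
    by (intro finite_measure_finite_Union) (auto simp: disjoint_family_on_def)
  also have "\<dots> = (LINT \<omega>|\<mu>. (\<Sum>\<xi>\<in>X. h \<xi> \<omega>))" using h by (simp add: Bochner_Integration.integral_sum)
  finally have A_int: "measure \<mu> A = (LINT \<omega>|\<mu>. (\<Sum>\<xi>\<in>X. h \<xi> \<omega>))" .
  have int: "integrable \<mu> (\<lambda>\<omega>. \<Sum>\<xi>\<in>X. h \<xi> \<omega>)" using h by auto
  \<comment> \<open>The exceptional null set depends on the pattern; finiteness of \<open>X\<close>
    allows a common one.\<close>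
  have "AE \<omega> in \<mu>. \<forall>\<xi>\<in>X. h \<xi> \<omega> = pmf (uniform_spec V E L \<Psi> (restrict \<omega> (V - \<Psi>))) \<xi>"
    using gibbs \<Psi> XC unfolding AE_finite_all[OF finX] gibbs_measure_def h_def space by blast
  hence "AE \<omega> in \<mu>. \<bar>(\<Sum>\<xi>\<in>X. h \<xi> \<omega>) - c\<bar> \<le> \<epsilon>"
  proof (rule AE_mp[OF _ AE_I2], intro impI)
    fix \<omega> assume "\<omega> \<in> space \<mu>"
      and eq: "\<forall>\<xi>\<in>X. h \<xi> \<omega> = pmf (uniform_spec V E L \<Psi> (restrict \<omega> (V - \<Psi>))) \<xi>"
    hence \<omega>: "\<omega> \<in> \<Omega>" by (simp add: space)
    have "(\<Sum>\<xi>\<in>X. h \<xi> \<omega>) = (\<Sum>\<xi>\<in>X. spec_prob \<Psi> \<omega> (pattern_event \<Psi> \<xi>))"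
      using eq spec_prob_eq_pmf[OF \<omega> \<Psi>(2,1)] by simp
    also have "\<dots> = spec_prob \<Psi> \<omega> A"
      unfolding A_eq using finX \<omega> \<Psi> by (intro spec_prob_UN[symmetric]) auto
    finally show "\<bar>(\<Sum>\<xi>\<in>X. h \<xi> \<omega>) - c\<bar> \<le> \<epsilon>" using near[OF \<omega>] by simp
  qed
  hence "AE \<omega> in \<mu>. (\<Sum>\<xi>\<in>X. h \<xi> \<omega>) \<le> c + \<epsilon>" "AE \<omega> in \<mu>. c - \<epsilon> \<le> (\<Sum>\<xi>\<in>X. h \<xi> \<omega>)"
    by (auto elim!: eventually_mono)
  thus ?thesis
    unfolding A_int abs_le_iff using integral_le_const[OF int] integral_ge_const[OF int] by fastforce
qed

lemma gibbs_measure_unique: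
  assumes "gibbs_measure V E L \<mu>" "gibbs_measure V E L \<nu>"
  shows "\<mu> = \<nu>"
proof -
  have eq: "measure \<mu> A = measure \<nu> A" if A: "A \<in> local_events V" for A
  proof (rule ccontr)
    assume "measure \<mu> A \<noteq> measure \<nu> A"
    \<comment> \<open>Both measures lie within \<epsilon> of the same finite-volume probability,
      hence within 2 \<epsilon> of each other, which is less than their distance 3
      \<epsilon>.\<close>
    define \<epsilon> where "\<epsilon> = \<bar>measure \<mu> A - measure \<nu> A\<bar> / 3"
    have \<epsilon>: "\<epsilon> > 0" using \<open>measure \<mu> A \<noteq> measure \<nu> A\<close> by (simp add: \<epsilon>_def)
    from spec_prob_decay[OF A this] obtain \<Psi> where \<Psi>: "finite \<Psi>" "\<Psi> \<subseteq> V" "A \<in> local_events \<Psi>"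
      "\<forall>\<omega>\<in>\<Omega>. \<forall>\<omega>'\<in>\<Omega>. \<bar>spec_prob \<Psi> \<omega> A - spec_prob \<Psi> \<omega>' A\<bar> \<le> \<epsilon>" by blast
    have "\<bar>measure \<kappa> A - spec_prob \<Psi> base A\<bar> \<le> \<epsilon>" if "gibbs_measure V E L \<kappa>" for \<kappa>
      by (rule gibbs_measure_near[OF that \<Psi>(1-3)]) (use \<Psi>(4) base_in_Omega in blast)
    from this[OF assms(1)] this[OF assms(2)]
    have "\<bar>measure \<mu> A - measure \<nu> A\<bar> \<le> 2 * \<epsilon>" by linarith
    thus False using \<epsilon> by (simp add: \<epsilon>_def)
  qed
  have sets: "sets \<mu> = sigma_sets \<Omega> (local_events V)" "sets \<nu> = sigma_sets \<Omega> (local_events V)"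
    and prob: "prob_space \<mu>" "prob_space \<nu>"
    using assms sets_coloring_space by (auto simp: gibbs_measure_def)
  have fin: "finite_measure \<mu>" "finite_measure \<nu>" using prob by (simp_all add: prob_space.finite_measure)
  show ?thesis
  proof (rule measure_eqI_generator_eq[OF Int_stable_local_events _ _ sets, where A = "\<lambda>_. \<Omega>"])
    show "local_events V \<subseteq> Pow \<Omega>" using local_events_subset by auto
    show "emeasure \<mu> A = emeasure \<nu> A" if "A \<in> local_events V" for A
      using eq[OF that] fin by (simp add: finite_measure.emeasure_eq_measure)
    show "emeasure \<mu> \<Omega> \<noteq> \<infinity>" for i :: nat
      using fin by (simp add: finite_measure.emeasure_eq_measure)
  qed (auto simp: Omega_in_local_events)
qed

end

text \<open>The root satisfies \<open>x = exp (1 / x)\<close> with \<open>x > 0\<close>. This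
  supplies \<alpha> \<ge> 1, the slack that pays for a lost color.\<close>

lemma alpha_star_gt_1: "alpha_star > 1"
proof -
  have root: "alpha_star * exp (- 1 / alpha_star) = 1"
    unfolding alpha_star_def by (rule theI'[OF alpha_star_unique])
  hence pos: "alpha_star > 0"
    by (metis exp_gt_zero zero_less_mult_pos2 zero_less_one)
  hence "exp (- 1 / alpha_star) < 1" by simp
  hence "alpha_star * exp (- 1 / alpha_star) < alpha_star * 1"
    using pos by (intro mult_strict_left_mono)
  thus ?thesis using root by simp
qed

theorem corollary2:
  fixes V :: "'v set" and E :: "'v set set" and L :: "'v \<Rightarrow> nat set"
    and D q :: nat and \<alpha> \<beta> :: real
  assumes "simple_graph V E" and "infinite V" and "triangle_free E"
    and "has_max_degree V E D"
    and "\<forall>v\<in>V. L v \<subseteq> {1..q}"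
    and "\<alpha> > alpha_star"
    and "\<beta> \<ge> sqrt 2 / (sqrt 2 - 1)"
    and "(1 - 1 / \<beta>) * \<alpha> * exp (- (1 / \<alpha>) * (1 + 1 / \<beta>)) > 1"
    and "\<forall>v\<in>V. real (card (L v)) \<ge> \<alpha> * real (vertex_degree E v) + \<beta>"
  shows "\<exists>!\<mu>. gibbs_measure V E L \<mu>"
proof -
  have sqrt2: "sqrt 2 > (1 :: real)" by simp
  hence "sqrt 2 / (sqrt 2 - 1) > (1 :: real)" by simp
  hence beta: "\<beta> > 1" using assms(7) by linarith
  have alpha: "\<alpha> \<ge> 1" using assms(6) alpha_star_gt_1 by linarith
  have edge: "u \<in> V \<and> u \<noteq> v" if "{u, v} \<in> E" for u v
    using assms(1) that unfolding simple_graph_def by (metis doubleton_eq_iff)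
  have "{v} \<notin> E" for v using edge[of v v] by auto
  then interpret sparse_graph E \<alpha> \<beta> V L D
    using assms(3,4,5,8,9) alpha beta edge
    by unfold_locales (auto simp: has_max_degree_def intro: finite_subset)
  show ?thesis using gibbs_measure_exists gibbs_measure_unique by blast
qed

end
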